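(* Let $n\geqslant 2$ and let $(\mathcal{C},\mathscr{E})$ be an idempotent complete exact category. Then: (1) $P$ is a projective object of $(\mathcal{C}[\epsilon]^n,\mathscr{E}_F)$ if and only if $P\cong T(Q)$ for some projective object $Q$ of $\mathcal{C}$. (2) $I$ is an injective object of $(\mathcal{C}[\epsilon]^n,\mathscr{E}_F)$ if and only if $I\cong T(E)$ for some injective object $E$ of $\mathcal{C}$.
   Context: Exact category is in the sense of Quillen: an additive category with a class $\mathscr{E}$ of kernel-cokernel pairs (short exact sequences) closed under isomorphism, such that identities are admissible monics and admissible epics, both classes are closed under composition, push-outs of admissible monics along arbitrary morphisms exist and are admissible monics, and dually for pull-backs of admissible epics. An object $P$ is projective if $\operatorname{Hom}(P,-)$ sends short exact sequences to short exact sequences of abelian groups; dually for injective. $\mathcal{C}$ is idempotent complete if every idempotent $e\in\operatorname{End}(X)$ factors as $e=\iota\pi$ with $\pi:X\to Y$, $\iota:Y\to X$, $\pi\iota=1_Y$. The category $\mathcal{C}[\epsilon]^n$ has as objects pairs $(X,\epsilon_X)$ with $X\in\mathcal{C}$, $\epsilon_X\in\operatorname{End}_{\mathcal{C}}(X)$, $\epsilon_X^n=0$; morphisms $(X,\epsilon_X)\to(Y,\epsilon_Y)$ are morphisms $f:X\to Y$ in $\mathcal{C}$ with $f\epsilon_X=\epsilon_Yf$. $F:\mathcal{C}[\epsilon]^n\to\mathcal{C}$, $(X,\epsilon_X)\mapsto X$, is the forgetful functor. $T:\mathcal{C}\to\mathcal{C}[\epsilon]^n$ sends $X$ to $(X^{\oplus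 n},\epsilon_{X^{\oplus n}})$, where $\epsilon_{X^{\oplus n}}$ is the $n\times n$ matrix with $1_X$ in positions $(i+1,i)$, $1\leqslant i\leqslant n-1$, and $0$ elsewhere, and sends $f$ to $\operatorname{diag}(f,\dots,f)$. $\mathscr{E}_F$ is the class of pairs of composable morphisms in $\mathcal{C}[\epsilon]^n$ that become short exact sequences in $(\mathcal{C},\mathscr{E})$ under $F$; it makes $\mathcal{C}[\epsilon]^n$ an exact category. *)

theory Defs
  imports "HOL-Algebra.Exact_Sequence" "HOL-Algebra.FiniteProduct"
begin

section \<open>Additive categories\<close>

text \<open>
  Composition is written in the usual order: \<open>g \<cdot> f\<close> is \<open>g\<close> after \<open>f\<close>. The sets
  \<open>Hom X Y\<close> are not required to be disjoint, so a bare element of type \<open>'m\<close> does not determine its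
  source and target; every notion below carries the objects along. This lets a morphism of
  \<open>C[\<epsilon>]\<^sup>n\<close> be literally a morphism of \<open>C\<close>.
\<close>

record ('o, 'm) additive_data =
  Obj :: "'o set"
  Hom :: "'o \<Rightarrow> 'o \<Rightarrow> 'm set"
  Idn :: "'o \<Rightarrow> 'm"
  Cmp :: "'m \<Rightarrow> 'm \<Rightarrow> 'm" (infixl "\<cdot>\<index>" 70)
  Add :: "'m \<Rightarrow> 'm \<Rightarrow> 'm" (infixl "\<boxplus>\<index>" 65)
  Zero :: "'o \<Rightarrow> 'o \<Rightarrow> 'm"

text \<open>The abelian group \<open>Hom X Y\<close>, in the multiplicative vocabulary of HOL-Algebra: its \<open>\<otimes>\<close> is the
  addition of morphisms, its \<open>\<one>\<close> the zero morphism, and its \<open>finprod\<close> a finite sum of morphisms.\<close>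

definition hom_group :: "('o, 'm) additive_data \<Rightarrow> 'o \<Rightarrow> 'o \<Rightarrow> 'm monoid" where
  "hom_group C X Y = \<lparr>carrier = Hom C X Y, mult = Add C, one = Zero C X Y\<rparr>"

definition End_monoid :: "('o, 'm) additive_data \<Rightarrow> 'o \<Rightarrow> 'm monoid" where
  "End_monoid C X = \<lparr>carrier = Hom C X X, mult = Cmp C, one = Idn C X\<rparr>"

locale category_axms =
  fixes C :: "('o, 'm) additive_data" (structure)
  assumes Idn_in: "X \<in> Obj C \<Longrightarrow> Idn C X \<in> Hom C X X"
    and Cmp_in: "\<lbrakk>X \<in> Obj C; Y \<in> Obj C; Z \<in> Obj C; f \<in> Hom C X Y; g \<in> Hom C Y Z\<rbrakk>
      \<Longrightarrow> g \<cdot> f \<in> Hom C X Z"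
    and Cmp_Idn: "\<lbrakk>X \<in> Obj C; Y \<in> Obj C; f \<in> Hom C X Y\<rbrakk> \<Longrightarrow> f \<cdot> Idn C X = f"
    and Idn_Cmp: "\<lbrakk>X \<in> Obj C; Y \<in> Obj C; f \<in> Hom C X Y\<rbrakk> \<Longrightarrow> Idn C Y \<cdot> f = f"
    and Cmp_assoc: "\<lbrakk>W \<in> Obj C; X \<in> Obj C; Y \<in> Obj C; Z \<in> Obj C;
        f \<in> Hom C W X; g \<in> Hom C X Y; h \<in> Hom C Y Z\<rbrakk>
      \<Longrightarrow> (h \<cdot> g) \<cdot> f = h \<cdot> (g \<cdot> f)"

locale preadditive_category = category_axms +
  assumes hom_comm_group: "\<lbrakk>X \<in> Obj C; Y \<in> Obj C\<rbrakk> \<Longrightarrow> comm_group (hom_group C X Y)"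
    and Cmp_Add_right: "\<lbrakk>X \<in> Obj C; Y \<in> Obj C; Z \<in> Obj C;
        f \<in> Hom C X Y; f' \<in> Hom C X Y; g \<in> Hom C Y Z\<rbrakk>
      \<Longrightarrow> g \<cdot> (f \<boxplus> f') = (g \<cdot> f) \<boxplus> (g \<cdot> f')"
    and Cmp_Add_left: "\<lbrakk>X \<in> Obj C; Y \<in> Obj C; Z \<in> Obj C;
        f \<in> Hom C X Y; g \<in> Hom C Y Z; g' \<in> Hom C Y Z\<rbrakk>
      \<Longrightarrow> (g \<boxplus> g') \<cdot> f = (g \<cdot> f) \<boxplus> (g' \<cdot> f)"

definition is_biproduct ::
  "('o, 'm) additive_data \<Rightarrow> nat \<Rightarrow> (nat \<Rightarrow> 'o) \<Rightarrow> 'o \<Rightarrow> (nat \<Rightarrow> 'm) \<Rightarrow> (nat \<Rightarrow> 'm) \<Rightarrow> bool" where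
  "is_biproduct C n X B \<iota> \<pi> \<longleftrightarrow>
     B \<in> Obj C \<and>
     (\<forall>i\<in>{1..n}. \<iota> i \<in> Hom C (X i) B \<and> \<pi> i \<in> Hom C B (X i)) \<and>
     (\<forall>i\<in>{1..n}. \<forall>j\<in>{1..n}.
        Cmp C (\<pi> i) (\<iota> j) = (if i = j then Idn C (X i) else Zero C (X j) (X i))) \<and>
     finprod (hom_group C B B) (\<lambda>i. Cmp C (\<iota> i) (\<pi> i)) {1..n} = Idn C B"

text \<open>All finite biproducts exist; the case \<open>n = 0\<close> gives an object with \<open>1 = 0\<close>, that is, a zero
  object.\<close>

locale additive_category = preadditive_category +
  assumes biproducts:
    "\<lbrakk>\<And>i. i \<in> {1..n} \<Longrightarrow> X i \<in> Obj C\<rbrakk> \<Longrightarrow> \<exists>B \<iota> \<pi>. is_biproduct C n X B \<iota> \<pi>"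

definition is_iso :: "('o, 'm) additive_data \<Rightarrow> 'o \<Rightarrow> 'o \<Rightarrow> 'm \<Rightarrow> bool" where
  "is_iso C X Y f \<longleftrightarrow> f \<in> Hom C X Y \<and>
     (\<exists>g\<in>Hom C Y X. Cmp C g f = Idn C X \<and> Cmp C f g = Idn C Y)"

definition isomorphic :: "('o, 'm) additive_data \<Rightarrow> 'o \<Rightarrow> 'o \<Rightarrow> bool" where
  "isomorphic C X Y \<longleftrightarrow> X \<in> Obj C \<and> Y \<in> Obj C \<and> (\<exists>f. is_iso C X Y f)"

definition idempotent_complete :: "('o, 'm) additive_data \<Rightarrow> bool" where
  "idempotent_complete C \<longleftrightarrow>
     (\<forall>X\<in>Obj C. \<forall>e\<in>Hom C X X. Cmp C e e = e \<longrightarrow>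
        (\<exists>Y\<in>Obj C. \<exists>\<pi>\<in>Hom C X Y. \<exists>\<iota>\<in>Hom C Y X. e = Cmp C \<iota> \<pi> \<and> Cmp C \<pi> \<iota> = Idn C Y))"

section \<open>Exact categories\<close>

text \<open>The sequence \<open>X \<rightarrow> Y \<rightarrow> Z\<close> with morphisms \<open>f\<close> and \<open>g\<close> is encoded as \<open>(X, f, Y, g, Z)\<close>.\<close>

type_synonym ('o, 'm) sequence = "'o \<times> 'm \<times> 'o \<times> 'm \<times> 'o"

definition is_kernel :: "('o, 'm) additive_data \<Rightarrow> 'o \<Rightarrow> 'm \<Rightarrow> 'o \<Rightarrow> 'm \<Rightarrow> 'o \<Rightarrow> bool" where
  "is_kernel C X f Y g Z \<longleftrightarrow> Cmp C g f = Zero C X Z \<and>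
     (\<forall>W\<in>Obj C. \<forall>h\<in>Hom C W Y. Cmp C g h = Zero C W Z \<longrightarrow>
        (\<exists>!k. k \<in> Hom C W X \<and> Cmp C f k = h))"

definition is_cokernel :: "('o, 'm) additive_data \<Rightarrow> 'o \<Rightarrow> 'm \<Rightarrow> 'o \<Rightarrow> 'm \<Rightarrow> 'o \<Rightarrow> bool" where
  "is_cokernel C X f Y g Z \<longleftrightarrow> Cmp C g f = Zero C X Z \<and>
     (\<forall>W\<in>Obj C. \<forall>h\<in>Hom C Y W. Cmp C h f = Zero C X W \<longrightarrow>
        (\<exists>!k. k \<in> Hom C Z W \<and> Cmp C k g = h))"

definition composable_pairs :: "('o, 'm) additive_data \<Rightarrow> ('o, 'm) sequence set" where
  "composable_pairs C = {(X, f, Y, g, Z).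
     X \<in> Obj C \<and> Y \<in> Obj C \<and> Z \<in> Obj C \<and> f \<in> Hom C X Y \<and> g \<in> Hom C Y Z}"

definition kernel_cokernel_pairs :: "('o, 'm) additive_data \<Rightarrow> ('o, 'm) sequence set" where
  "kernel_cokernel_pairs C = {(X, f, Y, g, Z).
     (X, f, Y, g, Z) \<in> composable_pairs C \<and> is_kernel C X f Y g Z \<and> is_cokernel C X f Y g Z}"

definition is_pushout ::
  "('o, 'm) additive_data \<Rightarrow> 'o \<Rightarrow> 'm \<Rightarrow> 'o \<Rightarrow> 'm \<Rightarrow> 'o \<Rightarrow> 'm \<Rightarrow> 'm \<Rightarrow> 'o \<Rightarrow> bool" where
  \<comment> \<open>the span is \<open>f : X \<rightarrow> Y\<close>, \<open>a : X \<rightarrow> X'\<close>, the cospan is \<open>f' : X' \<rightarrow> Y'\<close>, \<open>a' : Y \<rightarrow> Y'\<close>\<close>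
  "is_pushout C X f Y a X' f' a' Y' \<longleftrightarrow>
     Y' \<in> Obj C \<and> f' \<in> Hom C X' Y' \<and> a' \<in> Hom C Y Y' \<and> Cmp C f' a = Cmp C a' f \<and>
     (\<forall>W\<in>Obj C. \<forall>u\<in>Hom C X' W. \<forall>v\<in>Hom C Y W. Cmp C u a = Cmp C v f \<longrightarrow>
        (\<exists>!k. k \<in> Hom C Y' W \<and> Cmp C k f' = u \<and> Cmp C k a' = v))"

definition is_pullback ::
  "('o, 'm) additive_data \<Rightarrow> 'o \<Rightarrow> 'm \<Rightarrow> 'o \<Rightarrow> 'm \<Rightarrow> 'o \<Rightarrow> 'm \<Rightarrow> 'm \<Rightarrow> 'o \<Rightarrow> bool" where
  \<comment> \<open>the cospan is \<open>g : Y \<rightarrow> Z\<close>, \<open>c : Z' \<rightarrow> Z\<close>, the span is \<open>g' : Y' \<rightarrow> Z'\<close>, \<open>c' : Y' \<rightarrow> Y\<close>\<close>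
  "is_pullback C Y g Z c Z' g' c' Y' \<longleftrightarrow>
     Y' \<in> Obj C \<and> g' \<in> Hom C Y' Z' \<and> c' \<in> Hom C Y' Y \<and> Cmp C c g' = Cmp C g c' \<and>
     (\<forall>W\<in>Obj C. \<forall>u\<in>Hom C W Z'. \<forall>v\<in>Hom C W Y. Cmp C c u = Cmp C g v \<longrightarrow>
        (\<exists>!k. k \<in> Hom C W Y' \<and> Cmp C g' k = u \<and> Cmp C c' k = v))"

definition admissible_monic :: "('o, 'm) sequence set \<Rightarrow> 'o \<Rightarrow> 'm \<Rightarrow> 'o \<Rightarrow> bool" where
  "admissible_monic E X f Y \<longleftrightarrow> (\<exists>g Z. (X, f, Y, g, Z) \<in> E)"

definition admissible_epic :: "('o, 'm) sequence set \<Rightarrow> 'o \<Rightarrow> 'm \<Rightarrow> 'o \<Rightarrow> bool" where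
  "admissible_epic E Y g Z \<longleftrightarrow> (\<exists>X f. (X, f, Y, g, Z) \<in> E)"

locale exact_category = additive_category +
  fixes E :: "('o, 'm) sequence set"
  assumes E_kernel_cokernel: "E \<subseteq> kernel_cokernel_pairs C"
    and E_iso_closed:
      "\<lbrakk>(X, f, Y, g, Z) \<in> E; (X', f', Y', g', Z') \<in> composable_pairs C;
        is_iso C X X' a; is_iso C Y Y' b; is_iso C Z Z' c;
        f' \<cdot> a = b \<cdot> f; g' \<cdot> b = c \<cdot> g\<rbrakk> \<Longrightarrow> (X', f', Y', g', Z') \<in> E"
    and Idn_monic: "X \<in> Obj C \<Longrightarrow> admissible_monic E X (Idn C X) X"
    and Idn_epic: "X \<in> Obj C \<Longrightarrow> admissible_epic E X (Idn C X) X"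
    and monic_Cmp: "\<lbrakk>admissible_monic E X f Y; admissible_monic E Y g Z\<rbrakk>
      \<Longrightarrow> admissible_monic E X (g \<cdot> f) Z"
    and epic_Cmp: "\<lbrakk>admissible_epic E X f Y; admissible_epic E Y g Z\<rbrakk>
      \<Longrightarrow> admissible_epic E X (g \<cdot> f) Z"
    and monic_pushout: "\<lbrakk>admissible_monic E X f Y; X' \<in> Obj C; a \<in> Hom C X X'\<rbrakk>
      \<Longrightarrow> \<exists>Y' f' a'. is_pushout C X f Y a X' f' a' Y' \<and> admissible_monic E X' f' Y'"
    and epic_pullback: "\<lbrakk>admissible_epic E Y g Z; Z' \<in> Obj C; c \<in> Hom C Z' Z\<rbrakk>
      \<Longrightarrow> \<exists>Y' g' c'. is_pullback C Y g Z c Z' g' c' Y' \<and> admissible_epic E Y' g' Z'"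

text \<open>\<open>short_exact_sequence A B D f g\<close> of HOL-Algebra lists a sequence from right to left: it says
  that \<open>0 \<rightarrow> D \<rightarrow> B \<rightarrow> A \<rightarrow> 0\<close>, with the maps \<open>g : D \<rightarrow> B\<close> and \<open>f : B \<rightarrow> A\<close>, is exact.\<close>

definition projective_object ::
  "('o, 'm) additive_data \<Rightarrow> ('o, 'm) sequence set \<Rightarrow> 'o \<Rightarrow> bool" where
  "projective_object C E P \<longleftrightarrow> P \<in> Obj C \<and>
     (\<forall>X f Y g Z. (X, f, Y, g, Z) \<in> E \<longrightarrow>
        short_exact_sequence (hom_group C P Z) (hom_group C P Y) (hom_group C P X)
          (\<lambda>h. Cmp C g h) (\<lambda>h. Cmp C f h))"

definition injective_object ::
  "('o, 'm) additive_data \<Rightarrow> ('o, 'm) sequence set \<Rightarrow> 'o \<Rightarrow> bool" where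
  "injective_object C E I \<longleftrightarrow> I \<in> Obj C \<and>
     (\<forall>X f Y g Z. (X, f, Y, g, Z) \<in> E \<longrightarrow>
        short_exact_sequence (hom_group C X I) (hom_group C Y I) (hom_group C Z I)
          (\<lambda>h. Cmp C h f) (\<lambda>h. Cmp C h g))"

section \<open>The category \<open>C[\<epsilon>]\<^sup>n\<close>\<close>

definition nil_category ::
  "('o, 'm) additive_data \<Rightarrow> nat \<Rightarrow> ('o \<times> 'm, 'm) additive_data" where
  "nil_category C n = \<lparr>
     Obj = {(X, e). X \<in> Obj C \<and> e \<in> Hom C X X \<and> e [^]\<^bsub>End_monoid C X\<^esub> n = Zero C X X},
     Hom = (\<lambda>(X, e) (Y, e'). {f \<in> Hom C X Y. Cmp C f e = Cmp C e' f}),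
     Idn = (\<lambda>(X, e). Idn C X),
     Cmp = Cmp C,
     Add = Add C,
     Zero = (\<lambda>(X, e) (Y, e'). Zero C X Y)\<rparr>"

definition forget_obj :: "'o \<times> 'm \<Rightarrow> 'o" where
  "forget_obj = fst"

definition forget_mor :: "'m \<Rightarrow> 'm" where
  "forget_mor f = f"

definition forget_exact ::
  "('o, 'm) additive_data \<Rightarrow> ('o, 'm) sequence set \<Rightarrow> nat \<Rightarrow> ('o \<times> 'm, 'm) sequence set" where
  "forget_exact C E n = {(X, f, Y, g, Z).
     (X, f, Y, g, Z) \<in> composable_pairs (nil_category C n) \<and>
     (forget_obj X, forget_mor f, forget_obj Y, forget_mor g, forget_obj Z) \<in> E}"

text \<open>A choice, for each object \<open>X\<close>, of an \<open>n\<close>-fold biproduct of \<open>X\<close> with itself together with its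
  inclusions and projections.\<close>

definition power_data ::
  "('o, 'm) additive_data \<Rightarrow> nat \<Rightarrow> 'o \<Rightarrow> 'o \<times> (nat \<Rightarrow> 'm) \<times> (nat \<Rightarrow> 'm)" where
  "power_data C n X = (SOME (B, \<iota>, \<pi>). is_biproduct C n (\<lambda>_. X) B \<iota> \<pi>)"

definition power_obj :: "('o, 'm) additive_data \<Rightarrow> nat \<Rightarrow> 'o \<Rightarrow> 'o" where
  "power_obj C n X = fst (power_data C n X)"

definition power_incl :: "('o, 'm) additive_data \<Rightarrow> nat \<Rightarrow> 'o \<Rightarrow> nat \<Rightarrow> 'm" where
  "power_incl C n X = fst (snd (power_data C n X))"

definition power_proj :: "('o, 'm) additive_data \<Rightarrow> nat \<Rightarrow> 'o \<Rightarrow> nat \<Rightarrow> 'm" where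
  "power_proj C n X = snd (snd (power_data C n X))"

text \<open>The morphism from the \<open>n\<close>-th power of \<open>X\<close> to that of \<open>Y\<close> whose matrix has the entry
  \<open>A i j : X \<rightarrow> Y\<close> in row \<open>i\<close> and column \<open>j\<close>.\<close>

definition matrix_mor ::
  "('o, 'm) additive_data \<Rightarrow> nat \<Rightarrow> 'o \<Rightarrow> 'o \<Rightarrow> (nat \<Rightarrow> nat \<Rightarrow> 'm) \<Rightarrow> 'm" where
  "matrix_mor C n X Y A =
     finprod (hom_group C (power_obj C n X) (power_obj C n Y))
       (\<lambda>(i, j). Cmp C (Cmp C (power_incl C n Y i) (A i j)) (power_proj C n X j))
       ({1..n} \<times> {1..n})"

definition T_obj :: "('o, 'm) additive_data \<Rightarrow> nat \<Rightarrow> 'o \<Rightarrow> 'o \<times> 'm" where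
  "T_obj C n X = (power_obj C n X,
     matrix_mor C n X X (\<lambda>i j. if i = j + 1 then Idn C X else Zero C X X))"

definition T_mor :: "('o, 'm) additive_data \<Rightarrow> nat \<Rightarrow> 'o \<Rightarrow> 'o \<Rightarrow> 'm \<Rightarrow> 'm" where
  "T_mor C n X Y f = matrix_mor C n X Y (\<lambda>i j. if i = j then f else Zero C X Y)"

end

theory Submission
  imports Defs "HOL-Algebra.Ring"
begin

text \<open>
  Write \<open>n = m + 1\<close>. The functor \<open>T\<close> is left adjoint to \<open>F\<close>: a morphism \<open>T(Q) \<rightarrow> (Y, d)\<close> is the same
  thing as its restriction \<open>Q \<rightarrow> Y\<close> to the first summand (\<open>free_on_extend\<close>, \<open>free_on_unique\<close>). Since \<open>F\<close>
  preserves admissible epics, \<open>T(Q)\<close> is projective when \<open>Q\<close> is; the converse follows by restricting lifting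
  problems to targets with zero endomorphism.

  Let conversely \<open>P = (X, e)\<close> be projective. The counit \<open>T(X) \<rightarrow> P\<close> splits in \<open>C\<close>, and idempotent
  completeness makes split epics admissible, so \<open>P\<close> is a direct summand of \<open>T(X)\<close>. In terms of matrices
  this is an identity \<open>1 = h e\<^sup>m + e h e\<^bsup>m-1\<^esup> + \<dots> + e\<^sup>m h\<close> in the endomorphism ring of \<open>X\<close>
  (\<open>projective_contraction\<close>). What remains is algebra in one ring: \<open>h\<close> can be replaced by an element \<open>q\<close>
  satisfying the same identity together with \<open>q e\<^sup>m q = q\<close> and \<open>q e\<^sup>k q = 0\<close> for \<open>k < m\<close>
  (\<open>exists_matrix_unit\<close>). This imitates the proof that a projective module over \<open>A[e]/e\<^sup>n\<close> is induced from \<open>A\<close>: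
  the idempotent \<open>q e\<^sup>m\<close> cuts out a complement of the kernel of \<open>e\<^sup>m\<close>, its image \<open>Q\<close> generates \<open>X\<close> freely under \<open>e\<close>,
  and so \<open>P \<cong> T(Q)\<close> (\<open>free_on_of_contraction\<close>).

  The statement on injectives is the one on projectives for the opposite category. The object \<open>T(Q)\<close>
  involves a choice of a biproduct, which need not be respected by this duality, so \<open>P \<cong> T(Q)\<close> is
  expressed throughout by the self-dual predicate \<open>free_on\<close>.
\<close>

section \<open>Matrix units in a ring with a nilpotent element\<close>

text \<open>Truncating the geometric series at \<open>k\<close> leaves an error \<open>w\<^sup>k\<close> on either side, which
  vanishes for \<open>k = n\<close>. The partial sums are built by \<open>v \<mapsto> 1 + w v\<close>.\<close>

lemma (in ring) unit_of_one_minus_nilpotent: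
  assumes w: "w \<in> carrier R" and nil: "w [^] (n::nat) = \<zero>"
  obtains v where "v \<in> carrier R" "v \<otimes> (\<one> \<ominus> w) = \<one>" "(\<one> \<ominus> w) \<otimes> v = \<one>"
proof -
  have "\<exists>v\<in>carrier R. v \<otimes> (\<one> \<ominus> w) = \<one> \<ominus> w [^] k \<and> (\<one> \<ominus> w) \<otimes> v = \<one> \<ominus> w [^] k" for k :: nat
  proof (induction k)
    case 0
    show ?case using w by (intro bexI[of _ \<zero>]) (auto simp: r_neg minus_eq)
  next
    case (Suc k)
    then obtain v where v: "v \<in> carrier R" "v \<otimes> (\<one> \<ominus> w) = \<one> \<ominus> w [^] k"
      "(\<one> \<ominus> w) \<otimes> v = \<one> \<ominus> w [^] k" by blast
    let ?v = "\<one> \<oplus> w \<otimes> v"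
    have pw: "w \<otimes> w [^] k = w [^] Suc k" using w by (simp add: nat_pow_Suc2 del: nat_pow_Suc Group.nat_pow_Suc)
    have wk: "w [^] k \<in> carrier R" using w by simp
    have "?v \<otimes> (\<one> \<ominus> w) = (\<one> \<ominus> w) \<oplus> w \<otimes> (v \<otimes> (\<one> \<ominus> w))"
      using w v(1) by (simp add: l_distr m_assoc)
    also have "\<dots> = (\<one> \<ominus> w) \<oplus> (w \<ominus> w \<otimes> w [^] k)"
      unfolding v(2) using w wk by (simp add: minus_eq r_distr r_minus)
    also have "\<dots> = \<one> \<ominus> w [^] Suc k"
      unfolding pw using w wk by (simp add: minus_eq a_assoc r_neg1 l_neg r_neg r_neg2 del: nat_pow_Suc Group.nat_pow_Suc)
    finally have 1: "?v \<otimes> (\<one> \<ominus> w) = \<one> \<ominus> w [^] Suc k" .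
    have comm: "(\<one> \<ominus> w) \<otimes> w = w \<otimes> (\<one> \<ominus> w)"
      using w by (simp add: minus_eq l_distr r_distr l_minus r_minus)
    have "(\<one> \<ominus> w) \<otimes> ?v = (\<one> \<ominus> w) \<oplus> ((\<one> \<ominus> w) \<otimes> w) \<otimes> v"
      using w v(1) by (simp add: r_distr m_assoc)
    also have "\<dots> = (\<one> \<ominus> w) \<oplus> w \<otimes> ((\<one> \<ominus> w) \<otimes> v)"
      unfolding comm using w v(1) by (simp add: m_assoc)
    also have "\<dots> = (\<one> \<ominus> w) \<oplus> (w \<ominus> w \<otimes> w [^] k)"
      unfolding v(3) using w wk by (simp add: minus_eq r_distr r_minus)
    also have "\<dots> = \<one> \<ominus> w [^] Suc k"
      unfolding pw using w wk by (simp add: minus_eq a_assoc r_neg1 l_neg r_neg r_neg2 del: nat_pow_Suc Group.nat_pow_Suc)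
    finally have "(\<one> \<ominus> w) \<otimes> ?v = \<one> \<ominus> w [^] Suc k" .
    with 1 w v(1) show ?case by (intro bexI[of _ ?v]) auto
  qed
  from this[of n] nil that show ?thesis by (auto simp: minus_eq)
qed

text \<open>If \<open>e\<close> is nilpotent with \<open>e\<^bsup>m+1\<^esup> = 0\<close>, this sum commutes with \<open>e\<close>. For an endomorphism ring
  these sums are exactly the endomorphisms of \<open>(X, e)\<close> that factor through an object \<open>T(Y)\<close>, which
  is how projectivity enters the algebra.\<close>

definition transfer_sum :: "('a, 'b) ring_scheme \<Rightarrow> 'a \<Rightarrow> nat \<Rightarrow> 'a \<Rightarrow> 'a" where
  "transfer_sum R e m x =
     (\<Oplus>\<^bsub>R\<^esub>j\<in>{..m}. e [^]\<^bsub>R\<^esub> j \<otimes>\<^bsub>R\<^esub> x \<otimes>\<^bsub>R\<^esub> e [^]\<^bsub>R\<^esub> (m - j))"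

locale nilpotent_element = ring +
  fixes e m
  assumes e_in [simp]: "e \<in> carrier R" and e_nil: "e [^] Suc m = \<zero>"
begin

lemma pow_eq_zero: "m < k \<Longrightarrow> e [^] k = \<zero>"
proof -
  assume "m < k"
  then have "e [^] k = e [^] Suc m \<otimes> e [^] (k - Suc m)"
    by (simp add: nat_pow_mult del: nat_pow_Suc Group.nat_pow_Suc)
  then show ?thesis by (simp add: e_nil del: nat_pow_Suc Group.nat_pow_Suc)
qed

lemma pow_in [simp]: "e [^] (k::nat) \<in> carrier R" by simp

lemma transfer_sum_in [simp]: "x \<in> carrier R \<Longrightarrow> transfer_sum R e m x \<in> carrier R"
  unfolding transfer_sum_def by (auto intro!: finsum_closed)

lemma transfer_sum_r_commute:
  assumes "x \<in> carrier R" "v \<in> carrier R" "v \<otimes> e = e \<otimes> v"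
  shows "transfer_sum R e m (x \<otimes> v) = transfer_sum R e m x \<otimes> v"
proof -
  have vk: "v \<otimes> e [^] k = e [^] k \<otimes> v" for k :: nat
  proof (induction k)
    case (Suc k)
    then show ?case using assms by (simp add: m_assoc[symmetric]) (simp add: m_assoc)
  qed (use assms in simp)
  have "e [^] j \<otimes> (x \<otimes> v) \<otimes> e [^] (m - j) = e [^] j \<otimes> x \<otimes> e [^] (m - j) \<otimes> v" for j
    using assms vk by (simp add: m_assoc)
  then show ?thesis unfolding transfer_sum_def using assms
    by (subst finsum_ldistr) (auto intro!: finsum_cong')
qed

text \<open>On an element killed by \<open>e\<^bsup>k+1\<^esup>\<close>, multiplication by \<open>e\<^sup>k\<close> isolates one summand: those with
  larger \<open>j\<close> carry a power of \<open>e\<close> beyond \<open>m\<close> on the left, those with smaller \<open>j\<close> at least \<open>e\<^bsup>k+1\<^esup>\<close>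
  on the right.\<close>

lemma pow_transfer_sum:
  assumes x: "x \<in> carrier R" and y: "y \<in> carrier R" and ky: "e [^] Suc k \<otimes> y = \<zero>" and k: "k \<le> m"
  shows "e [^] k \<otimes> (transfer_sum R e m x \<otimes> y) = e [^] m \<otimes> x \<otimes> e [^] k \<otimes> y"
proof -
  have "e [^] k \<otimes> (transfer_sum R e m x \<otimes> y)
      = (\<Oplus>j\<in>{..m}. e [^] k \<otimes> (e [^] j \<otimes> x \<otimes> e [^] (m - j) \<otimes> y))"
    unfolding transfer_sum_def using x y
    by (subst finsum_ldistr) (auto simp: finsum_rdistr)
  also have "\<dots> = (\<Oplus>j\<in>{..m}. if m - k = j then e [^] m \<otimes> x \<otimes> e [^] k \<otimes> y else \<zero>)"
  proof (intro finsum_cong')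
    fix j assume "j \<in> {..m}"
    then have j: "j \<le> m" by simp
    have a: "e [^] k \<otimes> (e [^] j \<otimes> x \<otimes> e [^] (m - j) \<otimes> y) = e [^] (k + j) \<otimes> x \<otimes> (e [^] (m - j) \<otimes> y)"
      using x y by (simp add: m_assoc[symmetric] nat_pow_mult)
    consider "m - k < j" | "j = m - k" | "j < m - k" by linarith
    then show "e [^] k \<otimes> (e [^] j \<otimes> x \<otimes> e [^] (m - j) \<otimes> y) =
       (if m - k = j then e [^] m \<otimes> x \<otimes> e [^] k \<otimes> y else \<zero>)"
    proof cases
      case 1
      then show ?thesis unfolding a using x y k by (simp add: pow_eq_zero)
    next
      case 2
      then show ?thesis unfolding a using x y k by (simp add: m_assoc)
    next
      case 3
      then have "e [^] (m - j) = e [^] (m - j - Suc k) \<otimes> e [^] Suc k"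
        by (simp add: nat_pow_mult Suc_diff_Suc del: nat_pow_Suc Group.nat_pow_Suc)
      then have "e [^] (m - j) \<otimes> y = \<zero>" using ky y by (simp add: m_assoc del: nat_pow_Suc Group.nat_pow_Suc)
      then show ?thesis unfolding a using x 3 by simp
    qed
  qed (use x y in auto)
  also have "\<dots> = e [^] m \<otimes> x \<otimes> e [^] k \<otimes> y"
    using finsum_singleton[of "m - k" "{..m}" "\<lambda>_. e [^] m \<otimes> x \<otimes> e [^] k \<otimes> y"] x y by simp
  finally show ?thesis .
qed

text \<open>Both products are the same sum after a shift of the index by one, the boundary terms being
  multiples of \<open>e\<^bsup>m+1\<^esup>\<close>.\<close>

lemma transfer_sum_commutes:
  assumes x: "x \<in> carrier R"
  shows "e \<otimes> transfer_sum R e m x = transfer_sum R e m x \<otimes> e"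
proof (cases m)
  case 0
  then have "e = \<zero>" using e_nil by simp
  then show ?thesis using x transfer_sum_in[OF x] by simp
next
  case (Suc l)
  let ?g = "\<lambda>j. e [^] Suc j \<otimes> x \<otimes> e [^] (m - j)"
  have "e \<otimes> transfer_sum R e m x = (\<Oplus>j\<in>{..m}. ?g j)"
    unfolding transfer_sum_def using x
    by (subst finsum_rdistr) (auto intro!: finsum_cong' simp: m_assoc[symmetric] nat_pow_Suc2 simp del: nat_pow_Suc Group.nat_pow_Suc)
  also have "\<dots> = (\<Oplus>j\<in>{..l}. ?g j)"
    unfolding Suc using x e_nil[unfolded Suc] by (subst finsum_Suc) (auto simp del: nat_pow_Suc Group.nat_pow_Suc)
  also have "\<dots> = (\<Oplus>j\<in>{..m}. e [^] j \<otimes> x \<otimes> e [^] (Suc m - j))"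
    unfolding Suc using x e_nil[unfolded Suc] by (subst finsum_Suc2) (auto simp del: nat_pow_Suc Group.nat_pow_Suc)
  also have "\<dots> = transfer_sum R e m x \<otimes> e"
    unfolding transfer_sum_def using x
    by (subst finsum_ldistr) (auto intro!: finsum_cong' simp: m_assoc Suc_diff_le)
  finally show ?thesis .
qed

text \<open>The element \<open>u = transfer_sum x\<close> acts on \<open>e\<^sup>m\<close> like \<open>1\<close>, so \<open>w = 1 - u\<close> kills \<open>e\<^sup>m\<close>. Since \<open>1\<close> is a
  transfer sum, \<open>e\<^bsup>k+1\<^esup> y = 0\<close> implies that \<open>e\<^sup>k y\<close> is a multiple of \<open>e\<^sup>m\<close>, so that \<open>w e\<^sup>k y = 0\<close>; here \<open>y\<close> is
  a power of \<open>w\<close>. Descending from \<open>k = m\<close> to \<open>0\<close> shows \<open>w\<^bsup>m+1\<^esup> = 0\<close>, and \<open>u\<close> is invertible.\<close>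

lemma transfer_sum_normalize:
  assumes h: "h \<in> carrier R" "transfer_sum R e m h = \<one>"
    and x: "x \<in> carrier R" and top: "e [^] m \<otimes> x \<otimes> e [^] m = e [^] m"
  obtains v where "v \<in> carrier R" "v \<otimes> e = e \<otimes> v" "e [^] m \<otimes> v = e [^] m"
    "transfer_sum R e m (x \<otimes> v) = \<one>"
proof -
  let ?u = "transfer_sum R e m x"
  define w where "w = \<one> \<ominus> ?u"
  have [simp]: "?u \<in> carrier R" "w \<in> carrier R" using x by (auto simp: w_def)
  have u: "?u = \<one> \<ominus> w" by (simp add: w_def minus_eq minus_add r_neg1 a_assoc[symmetric] r_neg)
  have ew: "e \<otimes> w = w \<otimes> e"
    using transfer_sum_commutes[OF x] by (simp add: w_def minus_eq l_distr r_distr l_minus r_minus)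
  have wk: "w \<otimes> e [^] k = e [^] k \<otimes> w" for k :: nat
    by (induction k) (simp_all add: m_assoc[symmetric], simp add: m_assoc ew)
  have emu: "e [^] m \<otimes> ?u = e [^] m"
    using pow_transfer_sum[OF x one_closed, of m] x top e_nil by (simp del: nat_pow_Suc Group.nat_pow_Suc)
  have emw: "e [^] m \<otimes> w = \<zero>"
    using emu unfolding w_def by (simp add: minus_eq r_distr r_minus r_neg)
  have "e [^] (m - k) \<otimes> w [^] Suc k = \<zero>" if "k \<le> m" for k
    using that
  proof (induction k)
    case 0
    then show ?case using emw by simp
  next
    case (Suc k)
    let ?y = "w [^] Suc k"
    have y: "?y \<in> carrier R" by (simp del: nat_pow_Suc Group.nat_pow_Suc)
    have 1: "e [^] Suc (m - Suc k) \<otimes> ?y = \<zero>" using Suc by (simp add: Suc_diff_Suc del: nat_pow_Suc Group.nat_pow_Suc)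
    have "e [^] (m - Suc k) \<otimes> ?y = e [^] m \<otimes> h \<otimes> e [^] (m - Suc k) \<otimes> ?y"
      using pow_transfer_sum[OF h(1) y 1] h(2) y by (simp del: nat_pow_Suc Group.nat_pow_Suc)
    then have "w \<otimes> (e [^] (m - Suc k) \<otimes> ?y) = (w \<otimes> e [^] m) \<otimes> h \<otimes> e [^] (m - Suc k) \<otimes> ?y"
      using h y by (simp add: m_assoc del: nat_pow_Suc Group.nat_pow_Suc)
    also have "\<dots> = \<zero>" using h y by (simp add: wk emw del: nat_pow_Suc Group.nat_pow_Suc)
    finally have "e [^] (m - Suc k) \<otimes> (w \<otimes> ?y) = \<zero>"
      using y wk by (simp add: m_assoc[symmetric] del: nat_pow_Suc Group.nat_pow_Suc)
    then show ?case by (simp only: nat_pow_Suc2[OF \<open>w \<in> carrier R\<close>, of "Suc k"])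
  qed
  from this[of m] have "w [^] Suc m = \<zero>" by (simp del: nat_pow_Suc Group.nat_pow_Suc)
  then obtain v where v: "v \<in> carrier R" "v \<otimes> ?u = \<one>" "?u \<otimes> v = \<one>"
    unfolding u by (rule unit_of_one_minus_nilpotent[OF \<open>w \<in> carrier R\<close>]) blast
  have ve: "v \<otimes> e = e \<otimes> v"
  proof -
    have "v \<otimes> e = v \<otimes> (e \<otimes> (?u \<otimes> v))" using v by simp
    also have "\<dots> = v \<otimes> (e \<otimes> ?u) \<otimes> v" using v(1) by (simp add: m_assoc)
    also have "\<dots> = (v \<otimes> ?u) \<otimes> e \<otimes> v" using v(1) transfer_sum_commutes[OF x] by (simp add: m_assoc)
    finally show ?thesis using v(1,2) by simp
  qed
  have "e [^] m \<otimes> v = e [^] m \<otimes> ?u \<otimes> v" using emu by simp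
  also have "\<dots> = e [^] m" using v by (simp add: m_assoc)
  finally show ?thesis
    using that[OF v(1) ve] v(3) transfer_sum_r_commute[OF x v(1) ve] by simp
qed

text \<open>Expanding \<open>q e\<^sup>k = q \<cdot> transfer_sum q \<cdot> e\<^sup>k\<close>, the last summand already equals \<open>q e\<^sup>k\<close>, and by
  descending induction on \<open>k\<close> the only other possibly nonzero summand is \<open>q e\<^sup>k q e\<^sup>m\<close>. Hence the latter
  vanishes, and multiplying it by \<open>q\<close> on the right gives the claim.\<close>

lemma lower_corners_vanish:
  assumes q: "q \<in> carrier R" "transfer_sum R e m q = \<one>" "q \<otimes> e [^] m \<otimes> q = q"
    and k: "k < m"
  shows "q \<otimes> e [^] k \<otimes> q = \<zero>"
  using k
proof (induction k rule: measure_induct_rule[where f = "\<lambda>k. m - k"])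
  case (less k)
  then obtain l where l: "m = Suc l" by (cases m) auto
  let ?f = "\<lambda>j. q \<otimes> e [^] j \<otimes> q \<otimes> e [^] (m - j + k)"
  have "q \<otimes> e [^] k = q \<otimes> transfer_sum R e m q \<otimes> e [^] k" using q by simp
  also have "\<dots> = (\<Oplus>j\<in>{..m}. q \<otimes> (e [^] j \<otimes> q \<otimes> e [^] (m - j)) \<otimes> e [^] k)"
    unfolding transfer_sum_def using q(1)
    by (subst finsum_rdistr, simp, simp, simp, subst finsum_ldistr) auto
  also have "\<dots> = (\<Oplus>j\<in>{..m}. ?f j)"
    using q(1) by (auto intro!: finsum_cong' simp: m_assoc nat_pow_mult)
  also have "\<dots> = ?f m \<oplus> (\<Oplus>j\<in>{..l}. ?f j)"
    unfolding l using q(1) by (subst finsum_Suc) (auto simp: a_comm)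
  also have "(\<Oplus>j\<in>{..l}. ?f j) = (\<Oplus>j\<in>{..l}. if k = j then ?f j else \<zero>)"
  proof (intro finsum_cong')
    fix j assume "j \<in> {..l}"
    then have j: "j < m" using l by auto
    consider "j < k" | "j = k" | "k < j" by linarith
    then show "?f j = (if k = j then ?f j else \<zero>)"
    proof cases
      case 1
      then show ?thesis using less.prems q(1) by (simp add: pow_eq_zero)
    next
      case 3
      then show ?thesis using less.IH[of j] j q(1) by simp
    qed simp
  qed (use q(1) in auto)
  also have "\<dots> = ?f k"
    using less.prems l q(1) finsum_singleton[of k "{..l}" ?f] by simp
  finally have "q \<otimes> e [^] k = q \<otimes> e [^] k \<oplus> q \<otimes> e [^] k \<otimes> q \<otimes> e [^] m"
    using q less.prems by simp
  then have 1: "q \<otimes> e [^] k \<otimes> q \<otimes> e [^] m = \<zero>"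
    using q(1) by simp
  have "q \<otimes> e [^] k \<otimes> q = q \<otimes> e [^] k \<otimes> (q \<otimes> e [^] m \<otimes> q)" using q by simp
  also have "\<dots> = (q \<otimes> e [^] k \<otimes> q \<otimes> e [^] m) \<otimes> q" using q(1) by (simp add: m_assoc)
  finally show ?case using 1 q(1) by simp
qed

text \<open>From \<open>e\<^sup>m h e\<^sup>m = e\<^sup>m\<close> the element \<open>x = h e\<^sup>m h\<close> satisfies \<open>x e\<^sup>m x = x\<close>, but \<open>transfer_sum x\<close>
  need not be \<open>1\<close> any more. It is still a unit, and dividing \<open>x\<close> by it repairs this and keeps \<open>x e\<^sup>m x = x\<close>, because the
  unit acts as \<open>1\<close> on \<open>e\<^sup>m\<close>. The resulting \<open>e\<^sup>i q e\<^bsup>m-j\<^esup>\<close> are a full system of matrix units.\<close>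

theorem exists_matrix_unit:
  assumes h: "h \<in> carrier R" "transfer_sum R e m h = \<one>"
  obtains q where "q \<in> carrier R" "transfer_sum R e m q = \<one>" "q \<otimes> e [^] m \<otimes> q = q"
    "\<And>k. k < m \<Longrightarrow> q \<otimes> e [^] k \<otimes> q = \<zero>"
proof -
  have top: "e [^] m \<otimes> h \<otimes> e [^] m = e [^] m"
    using pow_transfer_sum[OF h(1) one_closed, of m] h e_nil by (simp del: nat_pow_Suc Group.nat_pow_Suc)
  let ?x = "h \<otimes> e [^] m \<otimes> h"
  have "e [^] m \<otimes> ?x \<otimes> e [^] m = (e [^] m \<otimes> h \<otimes> e [^] m) \<otimes> h \<otimes> e [^] m"
    using h(1) by (simp add: m_assoc)
  then have xtop: "e [^] m \<otimes> ?x \<otimes> e [^] m = e [^] m" using top by simp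
  obtain v where v: "v \<in> carrier R" "v \<otimes> e = e \<otimes> v" "e [^] m \<otimes> v = e [^] m"
    "transfer_sum R e m (?x \<otimes> v) = \<one>"
    using transfer_sum_normalize[OF h _ xtop] h(1) by auto
  have vm: "v \<otimes> e [^] m = e [^] m"
  proof -
    have "v \<otimes> e [^] k = e [^] k \<otimes> v" for k :: nat
      by (induction k) (use v in \<open>simp_all add: m_assoc[symmetric]\<close>, use v in \<open>simp add: m_assoc\<close>)
    then show ?thesis using v(3) by simp
  qed
  have "?x \<otimes> v \<otimes> e [^] m \<otimes> (?x \<otimes> v) = h \<otimes> (e [^] m \<otimes> h \<otimes> (v \<otimes> e [^] m)) \<otimes> h \<otimes> e [^] m \<otimes> h \<otimes> v"
    using h(1) v(1) by (simp add: m_assoc)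
  also have "\<dots> = h \<otimes> e [^] m \<otimes> h \<otimes> e [^] m \<otimes> h \<otimes> v" unfolding vm top ..
  also have "\<dots> = h \<otimes> (e [^] m \<otimes> h \<otimes> e [^] m) \<otimes> h \<otimes> v" using h(1) v(1) by (simp add: m_assoc)
  also have "\<dots> = ?x \<otimes> v" unfolding top ..
  finally have "?x \<otimes> v \<otimes> e [^] m \<otimes> (?x \<otimes> v) = ?x \<otimes> v" .
  then show ?thesis
    using that[of "?x \<otimes> v"] lower_corners_vanish[of "?x \<otimes> v"] v h(1) by simp
qed

end

section \<open>Preadditive categories and nilpotent endomorphisms\<close>

lemma hom_group_simps [simp]:
  "carrier (hom_group C X Y) = Hom C X Y" "mult (hom_group C X Y) = Add C"
  "one (hom_group C X Y) = Zero C X Y"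
  by (simp_all add: hom_group_def)

lemma hom_finprod:
  assumes G: "comm_group G" and H: "comm_group H" and h: "h \<in> hom G H" and f: "f \<in> A \<rightarrow> carrier G"
  shows "h (finprod G f A) = finprod H (\<lambda>i. h (f i)) A"
proof -
  interpret G: comm_group G by fact
  interpret H: comm_group H by fact
  interpret group_hom G H h by unfold_locales fact
  show ?thesis using f
  proof (induction A rule: infinite_finite_induct)
    case (insert a A)
    then have "f \<in> A \<rightarrow> carrier G" "f a \<in> carrier G" "(\<lambda>i. h (f i)) \<in> A \<rightarrow> carrier H" "h (f a) \<in> carrier H"
      by (auto simp: Pi_iff)
    then show ?case using insert by (simp add: G.finprod_closed)
  qed auto
qed

context preadditive_category
begin

lemma Zero_in: "X \<in> Obj C \<Longrightarrow> Y \<in> Obj C \<Longrightarrow> Zero C X Y \<in> Hom C X Y"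
  using monoid.one_closed[of "hom_group C X Y"] hom_comm_group[of X Y]
  by (simp add: comm_group_def comm_monoid_def)

lemma Add_in: "X \<in> Obj C \<Longrightarrow> Y \<in> Obj C \<Longrightarrow> f \<in> Hom C X Y \<Longrightarrow> g \<in> Hom C X Y \<Longrightarrow> f \<boxplus> g \<in> Hom C X Y"
  using monoid.m_closed[of "hom_group C X Y" f g] hom_comm_group[of X Y]
  by (simp add: comm_group_def comm_monoid_def)

lemma postcomp_hom:
  assumes "X \<in> Obj C" "Y \<in> Obj C" "Z \<in> Obj C" "g \<in> Hom C Y Z"
  shows "(\<lambda>f. g \<cdot> f) \<in> hom (hom_group C X Y) (hom_group C X Z)"
  using assms by (auto simp: hom_def Cmp_Add_right intro: Cmp_in)

lemma precomp_hom:
  assumes "X \<in> Obj C" "Y \<in> Obj C" "Z \<in> Obj C" "f \<in> Hom C X Y"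
  shows "(\<lambda>g. g \<cdot> f) \<in> hom (hom_group C Y Z) (hom_group C X Z)"
  using assms by (auto simp: hom_def Cmp_Add_left intro: Cmp_in)

lemma Cmp_Zero:
  assumes "X \<in> Obj C" "Y \<in> Obj C" "Z \<in> Obj C" "g \<in> Hom C Y Z"
  shows "g \<cdot> Zero C X Y = Zero C X Z"
  using hom_one[OF postcomp_hom[OF assms]] hom_comm_group assms
  by (simp add: comm_group_def)

lemma Zero_Cmp:
  assumes "X \<in> Obj C" "Y \<in> Obj C" "Z \<in> Obj C" "f \<in> Hom C X Y"
  shows "Zero C Y Z \<cdot> f = Zero C X Z"
  using hom_one[OF precomp_hom[OF assms]] hom_comm_group assms
  by (simp add: comm_group_def)

lemma Cmp_finprod:
  assumes "X \<in> Obj C" "Y \<in> Obj C" "Z \<in> Obj C" "g \<in> Hom C Y Z" "f \<in> A \<rightarrow> Hom C X Y"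
  shows "g \<cdot> finprod (hom_group C X Y) f A = finprod (hom_group C X Z) (\<lambda>i. g \<cdot> f i) A"
  using assms by (intro hom_finprod postcomp_hom) (auto intro: hom_comm_group)

lemma finprod_Cmp:
  assumes "X \<in> Obj C" "Y \<in> Obj C" "Z \<in> Obj C" "f \<in> Hom C X Y" "g \<in> A \<rightarrow> Hom C Y Z"
  shows "finprod (hom_group C Y Z) g A \<cdot> f = finprod (hom_group C X Z) (\<lambda>i. g i \<cdot> f) A"
  using assms by (intro hom_finprod[where h = "\<lambda>g. g \<cdot> f"] precomp_hom) (auto intro: hom_comm_group)

end

text \<open>The endomorphism ring, so that the ring-theoretic results apply to an object together with its
  nilpotent endomorphism.\<close>

definition End_ring :: "('o, 'm) additive_data \<Rightarrow> 'o \<Rightarrow> 'm ring" where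
  "End_ring C X = \<lparr>carrier = Hom C X X, mult = Cmp C, one = Idn C X, zero = Zero C X X, add = Add C\<rparr>"

lemma End_ring_simps [simp]:
  "carrier (End_ring C X) = Hom C X X" "mult (End_ring C X) = Cmp C" "one (End_ring C X) = Idn C X"
  "zero (End_ring C X) = Zero C X X" "add (End_ring C X) = Add C"
  by (simp_all add: End_ring_def)

lemma End_monoid_pow: "f [^]\<^bsub>End_monoid C X\<^esub> (k::nat) = f [^]\<^bsub>End_ring C X\<^esub> k"
  by (simp add: nat_pow_def End_monoid_def)

lemma (in preadditive_category) ring_End_ring: "X \<in> Obj C \<Longrightarrow> ring (End_ring C X)"
  by (intro ring.intro abelian_group.intro abelian_monoid.intro abelian_group_axioms.intro
      monoid.intro ring_axioms.intro)
    (auto simp: Idn_in Idn_Cmp Cmp_Idn Cmp_assoc Cmp_Add_left Cmp_Add_right simp flip: hom_group_def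
      intro: Cmp_in comm_group.axioms(1) hom_comm_group)

lemma transfer_sum_End_ring:
  "transfer_sum (End_ring C X) e m f = finprod (hom_group C X X)
     (\<lambda>j. Cmp C (Cmp C (e [^]\<^bsub>End_ring C X\<^esub> j) f) (e [^]\<^bsub>End_ring C X\<^esub> (m - j))) {..m}"
  by (simp add: transfer_sum_def finsum_def flip: hom_group_def)

lemma (in preadditive_category) pow_in:
  "X \<in> Obj C \<Longrightarrow> e \<in> Hom C X X \<Longrightarrow> e [^]\<^bsub>End_ring C X\<^esub> (k::nat) \<in> Hom C X X"
  using monoid.nat_pow_closed[of "End_ring C X" e k] ring.is_monoid[OF ring_End_ring, of X] by simp

lemma (in category_axms) commute_Cmp:
  assumes o: "X \<in> Obj C" "Y \<in> Obj C" "Z \<in> Obj C" "a \<in> Hom C X X" "b \<in> Hom C Y Y" "c \<in> Hom C Z Z"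
    "f \<in> Hom C X Y" "g \<in> Hom C Y Z" and fa: "f \<cdot> a = b \<cdot> f" and gb: "g \<cdot> b = c \<cdot> g"
  shows "(g \<cdot> f) \<cdot> a = c \<cdot> (g \<cdot> f)"
proof -
  have "(g \<cdot> f) \<cdot> a = g \<cdot> (b \<cdot> f)" using o fa by (simp add: Cmp_assoc[of X X Y Z])
  also have "\<dots> = (c \<cdot> g) \<cdot> f" using o gb by (simp add: Cmp_assoc[of X Y Y Z, symmetric])
  also have "\<dots> = c \<cdot> (g \<cdot> f)" using o by (simp add: Cmp_assoc[of X Y Z Z])
  finally show ?thesis .
qed

lemma (in preadditive_category) commute_pow:
  assumes "X \<in> Obj C" "Y \<in> Obj C" "e \<in> Hom C X X" "d \<in> Hom C Y Y" "f \<in> Hom C X Y" "f \<cdot> e = d \<cdot> f"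
  shows "f \<cdot> e [^]\<^bsub>End_ring C X\<^esub> (k::nat) = d [^]\<^bsub>End_ring C Y\<^esub> k \<cdot> f"
proof (induction k)
  case 0
  then show ?case using assms by (simp add: Cmp_Idn Idn_Cmp)
next
  case (Suc k)
  let ?e = "e [^]\<^bsub>End_ring C X\<^esub> k" and ?d = "d [^]\<^bsub>End_ring C Y\<^esub> k"
  have "f \<cdot> (?e \<cdot> e) = (f \<cdot> ?e) \<cdot> e" 
    using assms by (simp add: Cmp_assoc[of X X X Y] pow_in)
  also have "\<dots> = ?d \<cdot> (d \<cdot> f)" using assms Suc by (simp add: Cmp_assoc[of X X Y Y] pow_in)
  also have "\<dots> = ?d \<cdot> d \<cdot> f" using assms by (simp add: Cmp_assoc[of X Y Y Y] pow_in)
  finally show ?case by simp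
qed

lemma nil_category_simps [simp]:
  "P \<in> Obj (nil_category C n) \<longleftrightarrow> fst P \<in> Obj C \<and> snd P \<in> Hom C (fst P) (fst P)
     \<and> snd P [^]\<^bsub>End_ring C (fst P)\<^esub> n = Zero C (fst P) (fst P)"
  "f \<in> Hom (nil_category C n) P P' \<longleftrightarrow> f \<in> Hom C (fst P) (fst P') \<and> Cmp C f (snd P) = Cmp C (snd P') f"
  "Idn (nil_category C n) P = Idn C (fst P)"
  "Cmp (nil_category C n) = Cmp C"
  "Add (nil_category C n) = Add C"
  "Zero (nil_category C n) P P' = Zero C (fst P) (fst P')"
  by (cases P, cases P', simp add: nil_category_def End_monoid_pow)+

lemma (in preadditive_category) preadditive_nil_category: "preadditive_category (nil_category C n)"
proof (intro preadditive_category.intro category_axms.intro preadditive_category_axioms.intro)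
  fix P P' assume P: "P \<in> Obj (nil_category C n)" "P' \<in> Obj (nil_category C n)"
  let ?G = "hom_group C (fst P) (fst P')" and ?H = "Hom (nil_category C n) P P'"
  interpret comm_group ?G using P by (intro hom_comm_group) auto
  have "subgroup ?H ?G"
  proof
    show "?H \<subseteq> carrier ?G" by auto
    show "\<one>\<^bsub>?G\<^esub> \<in> ?H" using P
      by (simp add: Zero_in Cmp_Zero[of "fst P" "fst P'" "fst P'"] Zero_Cmp[of "fst P" "fst P" "fst P'"])
  next
    fix x y assume "x \<in> ?H" "y \<in> ?H"
    then show "x \<otimes>\<^bsub>?G\<^esub> y \<in> ?H" using P
      by (auto simp: Add_in Cmp_Add_left[of "fst P" "fst P"] Cmp_Add_right[of _ "fst P'"])
  next
    fix x assume x: "x \<in> ?H"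
    let ?x = "inv\<^bsub>?G\<^esub> x"
    have i: "?x \<in> Hom C (fst P) (fst P')" using x inv_closed[of x] by simp
    interpret a: group_hom ?G ?G "\<lambda>f. f \<cdot> snd P"
      using P precomp_hom[of "fst P" "fst P"] by unfold_locales auto
    interpret b: group_hom ?G ?G "\<lambda>f. snd P' \<cdot> f"
      using P postcomp_hom[of "fst P" "fst P'"] by unfold_locales auto
    show "?x \<in> ?H" using x i a.hom_inv[of x] b.hom_inv[of x] by simp
  qed
  then interpret H: group "?G\<lparr>carrier := ?H\<rparr>" by (rule subgroup_imp_group)
  have "hom_group (nil_category C n) P P' = ?G\<lparr>carrier := ?H\<rparr>" by (simp add: hom_group_def)
  moreover have "comm_group (?G\<lparr>carrier := ?H\<rparr>)"
    by (rule H.group_comm_groupI) (use m_comm in auto)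
  ultimately show "comm_group (hom_group (nil_category C n) P P')" by (simp only:)
next
  fix X Y Z f g
  assume "X \<in> Obj (nil_category C n)" "Y \<in> Obj (nil_category C n)" "Z \<in> Obj (nil_category C n)"
    "f \<in> Hom (nil_category C n) X Y" "g \<in> Hom (nil_category C n) Y Z"
  then show "g \<cdot>\<^bsub>nil_category C n\<^esub> f \<in> Hom (nil_category C n) X Z"
    using Cmp_in[of "fst X" "fst Y" "fst Z" f g]
      commute_Cmp[of "fst X" "fst Y" "fst Z" "snd X" "snd Y" "snd Z" f g] by simp
next
  fix W X Y Z f g h
  assume "W \<in> Obj (nil_category C n)" "X \<in> Obj (nil_category C n)" "Y \<in> Obj (nil_category C n)"
    "Z \<in> Obj (nil_category C n)" "f \<in> Hom (nil_category C n) W X" "g \<in> Hom (nil_category C n) X Y"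
    "h \<in> Hom (nil_category C n) Y Z"
  then show "(h \<cdot>\<^bsub>nil_category C n\<^esub> g) \<cdot>\<^bsub>nil_category C n\<^esub> f
      = h \<cdot>\<^bsub>nil_category C n\<^esub> (g \<cdot>\<^bsub>nil_category C n\<^esub> f)"
    using Cmp_assoc[of "fst W" "fst X" "fst Y" "fst Z" f g h] by simp
next
  fix X Y Z f f' g
  assume "X \<in> Obj (nil_category C n)" "Y \<in> Obj (nil_category C n)" "Z \<in> Obj (nil_category C n)"
    "f \<in> Hom (nil_category C n) X Y" "f' \<in> Hom (nil_category C n) X Y" "g \<in> Hom (nil_category C n) Y Z"
  then show "g \<cdot>\<^bsub>nil_category C n\<^esub> (f \<boxplus>\<^bsub>nil_category C n\<^esub> f')
      = (g \<cdot>\<^bsub>nil_category C n\<^esub> f) \<boxplus>\<^bsub>nil_category C n\<^esub> (g \<cdot>\<^bsub>nil_category C n\<^esub> f')"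
    using Cmp_Add_right[of "fst X" "fst Y" "fst Z" f f' g] by simp
next
  fix X Y Z f g g'
  assume "X \<in> Obj (nil_category C n)" "Y \<in> Obj (nil_category C n)" "Z \<in> Obj (nil_category C n)"
    "f \<in> Hom (nil_category C n) X Y" "g \<in> Hom (nil_category C n) Y Z" "g' \<in> Hom (nil_category C n) Y Z"
  then show "(g \<boxplus>\<^bsub>nil_category C n\<^esub> g') \<cdot>\<^bsub>nil_category C n\<^esub> f
      = (g \<cdot>\<^bsub>nil_category C n\<^esub> f) \<boxplus>\<^bsub>nil_category C n\<^esub> (g' \<cdot>\<^bsub>nil_category C n\<^esub> f)"
    using Cmp_Add_left[of "fst X" "fst Y" "fst Z" f g g'] by simp
qed (auto simp: Idn_in Cmp_Idn Idn_Cmp[of "fst X" "fst X" for X] intro: Cmp_Idn Idn_Cmp)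

lemma (in preadditive_category) kernel_monic:
  assumes ker: "is_kernel C X f Y g Z" and o: "X \<in> Obj C" "Y \<in> Obj C" "Z \<in> Obj C" "f \<in> Hom C X Y" "g \<in> Hom C Y Z"
    and W: "W \<in> Obj C" and hk: "h \<in> Hom C W X" "k \<in> Hom C W X" "f \<cdot> h = f \<cdot> k"
  shows "h = k"
proof -
  have "f \<cdot> k \<in> Hom C W Y" using o W hk by (intro Cmp_in[of W X Y])
  moreover have "g \<cdot> (f \<cdot> k) = Zero C W Z"
    using ker o W hk by (simp add: is_kernel_def Cmp_assoc[of W X Y Z, symmetric] Zero_Cmp[of W X])
  ultimately have "\<exists>!l. l \<in> Hom C W X \<and> f \<cdot> l = f \<cdot> k"
    using ker W unfolding is_kernel_def by blast
  then show ?thesis using hk by blast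
qed

text \<open>The functor \<open>Hom(P, -)\<close> preserves kernels for every \<open>P\<close>, so exactness of the sequence of
  \<open>Hom\<close> groups reduces to surjectivity of its last map.\<close>

lemma (in preadditive_category) projective_iff_lifting:
  assumes E: "\<And>X f Y g Z. (X, f, Y, g, Z) \<in> E \<Longrightarrow> (X, f, Y, g, Z) \<in> composable_pairs C \<and> is_kernel C X f Y g Z"
  shows "projective_object C E P \<longleftrightarrow> P \<in> Obj C \<and>
    (\<forall>Y g Z. admissible_epic E Y g Z \<longrightarrow> (\<forall>h\<in>Hom C P Z. \<exists>k\<in>Hom C P Y. g \<cdot> k = h))"
proof -
  have "short_exact_sequence (hom_group C P Z) (hom_group C P Y) (hom_group C P X) (\<lambda>h. g \<cdot> h) (\<lambda>h. f \<cdot> h)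
     \<longleftrightarrow> (\<forall>h\<in>Hom C P Z. \<exists>k\<in>Hom C P Y. g \<cdot> k = h)"
    if P: "P \<in> Obj C" and s: "(X, f, Y, g, Z) \<in> E" for X f Y g Z
  proof -
    have o: "X \<in> Obj C" "Y \<in> Obj C" "Z \<in> Obj C" "f \<in> Hom C X Y" "g \<in> Hom C Y Z"
      and ker: "is_kernel C X f Y g Z"
      using E[OF s] by (auto simp: composable_pairs_def)
    have gr: "group (hom_group C P X)" "group (hom_group C P Y)" "group (hom_group C P Z)"
      using hom_comm_group P o by (auto intro: comm_group.axioms(2))
    have gf: "g \<cdot> f = Zero C X Z" using ker by (simp add: is_kernel_def)
    have inj: "inj_on (\<lambda>h. f \<cdot> h) (Hom C P X)"
    proof (rule inj_onI)
      fix h k assume "h \<in> Hom C P X" "k \<in> Hom C P X" "f \<cdot> h = f \<cdot> k"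
      then show "h = k" by (rule kernel_monic[OF ker o P])
    qed
    have "kernel (hom_group C P Y) (hom_group C P Z) (\<lambda>h. g \<cdot> h) = (\<lambda>h. f \<cdot> h) ` Hom C P X"
    proof (intro equalityI subsetI)
      fix h assume "h \<in> kernel (hom_group C P Y) (hom_group C P Z) (\<lambda>h. g \<cdot> h)"
      then show "h \<in> (\<lambda>h. f \<cdot> h) ` Hom C P X"
        using ker P unfolding kernel_def is_kernel_def by simp blast
    next
      fix h assume "h \<in> (\<lambda>h. f \<cdot> h) ` Hom C P X"
      then obtain k where k: "k \<in> Hom C P X" "h = f \<cdot> k" by auto
      have "g \<cdot> (f \<cdot> k) = Zero C P Z"
        using P o k gf by (simp add: Cmp_assoc[of P X Y Z, symmetric] Zero_Cmp[of P X])
      then show "h \<in> kernel (hom_group C P Y) (hom_group C P Z) (\<lambda>h. g \<cdot> h)"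
        using P o k by (auto simp: kernel_def intro: Cmp_in)
    qed
    then have "short_exact_sequence (hom_group C P Z) (hom_group C P Y) (hom_group C P X) (\<lambda>h. g \<cdot> h) (\<lambda>h. f \<cdot> h)
        \<longleftrightarrow> (\<lambda>h. g \<cdot> h) ` Hom C P Y = Hom C P Z"
      using postcomp_hom[of P X Y f] postcomp_hom[of P Y Z g] P o gr inj
      by (simp add: short_exact_sequence_iff group_hom_def group_hom_axioms_def mon_def epi_def)
    also have "\<dots> \<longleftrightarrow> (\<forall>h\<in>Hom C P Z. \<exists>k\<in>Hom C P Y. g \<cdot> k = h)"
    proof -
      have "(\<lambda>h. g \<cdot> h) ` Hom C P Y \<subseteq> Hom C P Z" using Cmp_in[of P Y Z _ g] P o by auto
      then have "(\<lambda>h. g \<cdot> h) ` Hom C P Y = Hom C P Z \<longleftrightarrow> Hom C P Z \<subseteq> (\<lambda>h. g \<cdot> h) ` Hom C P Y"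
        by (simp add: set_eq_subset)
      also have "\<dots> \<longleftrightarrow> (\<forall>h\<in>Hom C P Z. \<exists>k\<in>Hom C P Y. h = g \<cdot> k)" by (simp add: subset_iff image_iff Ball_def)
      finally show ?thesis by (simp only: eq_commute)
    qed
    finally show ?thesis .
  qed
  then have "projective_object C E P \<longleftrightarrow> P \<in> Obj C \<and>
      (\<forall>X f Y g Z. (X, f, Y, g, Z) \<in> E \<longrightarrow> (\<forall>h\<in>Hom C P Z. \<exists>k\<in>Hom C P Y. g \<cdot> k = h))"
    unfolding projective_object_def by blast
  moreover have "(\<forall>X f Y g Z. (X, f, Y, g, Z) \<in> E \<longrightarrow> R Y g Z) \<longleftrightarrow>
      (\<forall>Y g Z. admissible_epic E Y g Z \<longrightarrow> R Y g Z)" for R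
    unfolding admissible_epic_def by blast
  ultimately show ?thesis by (simp only:)
qed

section \<open>Objects freely generated under a nilpotent endomorphism\<close>

text \<open>The two equations say that \<open>\<alpha>, e\<alpha>, \<dots>, e\<^sup>m\<alpha>\<close> and \<open>\<beta>e\<^sup>m, \<dots>, \<beta>e, \<beta>\<close> are the inclusions and projections
  of a biproduct of \<open>m + 1\<close> copies of \<open>Q\<close>, with \<open>e\<close> as the shift. This is a description of
  \<open>P \<cong> T(Q)\<close> without the chosen biproduct and, unlike a universal property, it is unchanged
  when all arrows are reversed and \<open>\<alpha>\<close> and \<open>\<beta>\<close> are exchanged.\<close>

definition free_on :: "('o, 'm) additive_data \<Rightarrow> nat \<Rightarrow> 'o \<times> 'm \<Rightarrow> 'o \<Rightarrow> 'm \<Rightarrow> 'm \<Rightarrow> bool" where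
  "free_on C m P Q \<alpha> \<beta> \<longleftrightarrow>
     P \<in> Obj (nil_category C (Suc m)) \<and> Q \<in> Obj C \<and> \<alpha> \<in> Hom C Q (fst P) \<and> \<beta> \<in> Hom C (fst P) Q \<and>
     (\<forall>k\<le>m. Cmp C (Cmp C \<beta> (snd P [^]\<^bsub>End_ring C (fst P)\<^esub> k)) \<alpha> = (if k = m then Idn C Q else Zero C Q Q)) \<and>
     transfer_sum (End_ring C (fst P)) (snd P) m (Cmp C \<alpha> \<beta>) = Idn C (fst P)"

lemma (in preadditive_category) nilpotent_End:
  "P \<in> Obj (nil_category C (Suc m)) \<Longrightarrow> nilpotent_element (End_ring C (fst P)) (snd P) m"
  by (intro nilpotent_element.intro nilpotent_element_axioms.intro ring_End_ring) simp_all

context preadditive_category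
begin

text \<open>Insert \<open>1 = transfer_sum (\<alpha> \<beta>)\<close> after \<open>f\<close> and move \<open>f\<close> past the powers of the endomorphism. So a
  morphism on a free object is determined by its restriction along \<open>\<alpha>\<close>.\<close>

lemma free_on_expand:
  assumes free: "free_on C m P Q \<alpha> \<beta>" and R: "R \<in> Obj (nil_category C (Suc m))"
    and f: "f \<in> Hom (nil_category C (Suc m)) P R"
  shows "f = finprod (hom_group C (fst P) (fst R))
    (\<lambda>j. (snd R [^]\<^bsub>End_ring C (fst R)\<^esub> j \<cdot> (f \<cdot> \<alpha>)) \<cdot> (\<beta> \<cdot> snd P [^]\<^bsub>End_ring C (fst P)\<^esub> (m - j))) {..m}"
proof -
  obtain X e Y d where P [simp]: "P = (X, e)" and R' [simp]: "R = (Y, d)" by (cases P, cases R)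
  have o: "X \<in> Obj C" "Y \<in> Obj C" "Q \<in> Obj C" "e \<in> Hom C X X" "d \<in> Hom C Y Y" "\<alpha> \<in> Hom C Q X" "\<beta> \<in> Hom C X Q"
    "f \<in> Hom C X Y" "f \<cdot> e = d \<cdot> f"
    using free R f by (auto simp: free_on_def)
  let ?e = "\<lambda>k::nat. e [^]\<^bsub>End_ring C X\<^esub> k" and ?d = "\<lambda>k::nat. d [^]\<^bsub>End_ring C Y\<^esub> k"
  have [simp]: "?e k \<in> Hom C X X" "?d k \<in> Hom C Y Y" for k using o by (auto intro: pow_in)
  have ab: "\<alpha> \<cdot> \<beta> \<in> Hom C X X" using o by (intro Cmp_in[of X Q X])
  have "f = f \<cdot> Idn C X" using o by (simp add: Cmp_Idn)
  also have "\<dots> = f \<cdot> finprod (hom_group C X X) (\<lambda>j. (?e j \<cdot> (\<alpha> \<cdot> \<beta>)) \<cdot> ?e (m - j)) {..m}"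
    using free by (simp add: free_on_def transfer_sum_End_ring)
  also have "\<dots> = finprod (hom_group C X Y) (\<lambda>j. f \<cdot> ((?e j \<cdot> (\<alpha> \<cdot> \<beta>)) \<cdot> ?e (m - j))) {..m}"
    using o ab by (intro Cmp_finprod) (auto intro!: Cmp_in[of X X X])
  also have "(\<lambda>j. f \<cdot> ((?e j \<cdot> (\<alpha> \<cdot> \<beta>)) \<cdot> ?e (m - j))) = (\<lambda>j. (?d j \<cdot> (f \<cdot> \<alpha>)) \<cdot> (\<beta> \<cdot> ?e (m - j)))"
  proof
    fix j
    have i: "\<beta> \<cdot> ?e (m - j) \<in> Hom C X Q" using o by (intro Cmp_in[of X X Q]) auto
    have "f \<cdot> ((?e j \<cdot> (\<alpha> \<cdot> \<beta>)) \<cdot> ?e (m - j)) = f \<cdot> (?e j \<cdot> (\<alpha> \<cdot> (\<beta> \<cdot> ?e (m - j))))"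
      using o ab by (simp add: Cmp_assoc[of X X X X] Cmp_assoc[of X X Q X])
    also have "\<dots> = (f \<cdot> ?e j) \<cdot> (\<alpha> \<cdot> (\<beta> \<cdot> ?e (m - j)))"
      using o i Cmp_in[of X Q X, OF _ _ _ i, of \<alpha>] by (simp add: Cmp_assoc[of X X X Y])
    also have "\<dots> = (?d j \<cdot> f) \<cdot> (\<alpha> \<cdot> (\<beta> \<cdot> ?e (m - j)))"
      using commute_pow[of X Y e d f j] o by simp
    also have "\<dots> = ?d j \<cdot> (f \<cdot> (\<alpha> \<cdot> (\<beta> \<cdot> ?e (m - j))))"
      using o i Cmp_in[of X Q X, OF _ _ _ i, of \<alpha>] by (simp add: Cmp_assoc[of X X Y Y])
    also have "\<dots> = ?d j \<cdot> ((f \<cdot> \<alpha>) \<cdot> (\<beta> \<cdot> ?e (m - j)))"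
      using o i by (simp add: Cmp_assoc[of X Q X Y])
    also have "\<dots> = (?d j \<cdot> (f \<cdot> \<alpha>)) \<cdot> (\<beta> \<cdot> ?e (m - j))"
      using o i Cmp_in[of Q X Y \<alpha> f] by (simp add: Cmp_assoc[of X Q Y Y])
    finally show "f \<cdot> ((?e j \<cdot> (\<alpha> \<cdot> \<beta>)) \<cdot> ?e (m - j)) = (?d j \<cdot> (f \<cdot> \<alpha>)) \<cdot> (\<beta> \<cdot> ?e (m - j))" .
  qed
  finally show ?thesis by simp
qed

lemma free_on_unique:
  assumes "free_on C m P Q \<alpha> \<beta>" "R \<in> Obj (nil_category C (Suc m))"
    "f \<in> Hom (nil_category C (Suc m)) P R" "g \<in> Hom (nil_category C (Suc m)) P R" "f \<cdot> \<alpha> = g \<cdot> \<alpha>"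
  shows "f = g"
  using free_on_expand[OF assms(1,2,3)] free_on_expand[OF assms(1,2,4)] assms(5) by simp

text \<open>Together with uniqueness this is the adjunction \<open>Hom(T(Q), R) \<cong> Hom(Q, F(R))\<close>. The extension is
  the sum dictated by the expansion above; it is compatible with the nilpotent endomorphisms for the same
  reason that transfer sums commute with \<open>e\<close>.\<close>

lemma free_on_extend:
  assumes free: "free_on C m P Q \<alpha> \<beta>" and R: "R \<in> Obj (nil_category C (Suc m))"
    and h: "h \<in> Hom C Q (fst R)"
  obtains f where "f \<in> Hom (nil_category C (Suc m)) P R" "f \<cdot> \<alpha> = h"
proof -
  obtain X e Y d where P [simp]: "P = (X, e)" and R' [simp]: "R = (Y, d)" by (cases P, cases R)
  have o: "X \<in> Obj C" "Y \<in> Obj C" "Q \<in> Obj C" "e \<in> Hom C X X" "d \<in> Hom C Y Y" "\<alpha> \<in> Hom C Q X" "\<beta> \<in> Hom C X Q"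
    "h \<in> Hom C Q Y"
    using free R h by (auto simp: free_on_def)
  interpret e: nilpotent_element "End_ring C X" e m using nilpotent_End[of P] free by (simp add: free_on_def)
  interpret d: nilpotent_element "End_ring C Y" d m using nilpotent_End[of R] R by simp
  interpret XY: comm_group "hom_group C X Y" using o by (intro hom_comm_group)
  interpret QY: comm_group "hom_group C Q Y" using o by (intro hom_comm_group)
  let ?e = "\<lambda>k::nat. e [^]\<^bsub>End_ring C X\<^esub> k" and ?d = "\<lambda>k::nat. d [^]\<^bsub>End_ring C Y\<^esub> k"
  \<comment> \<open>Moving \<open>d\<close> or \<open>e\<close> into a summand \<open>a j \<cdot> b k\<close> raises one index by one.\<close>
  define a b where "a = (\<lambda>k. ?d k \<cdot> h)" and "b = (\<lambda>k. \<beta> \<cdot> ?e k)"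
  have pw: "?e k \<in> Hom C X X" "?d k \<in> Hom C Y Y" for k using o by (auto intro: pow_in)
  have a_in: "a k \<in> Hom C Q Y" and b_in: "b k \<in> Hom C X Q" for k
    unfolding a_def b_def using o pw by (auto intro: Cmp_in[of Q Y Y] Cmp_in[of X X Q])
  have ab_in [simp]: "a j \<cdot> b k \<in> Hom C X Y" for j k using a_in b_in o by (intro Cmp_in[of X Q Y])
  have da: "d \<cdot> a k = a (Suc k)" for k
    using o pw d.nat_pow_Suc2[of d k] by (simp add: a_def Cmp_assoc[of Q Y Y Y, symmetric] del: Group.nat_pow_Suc d.nat_pow_Suc)
  have be: "b k \<cdot> e = b (Suc k)" for k using o pw by (simp add: b_def Cmp_assoc[of X X X Q])
  have a0: "a (Suc m) = Zero C Q Y" and b0: "b (Suc m) = Zero C X Q" and ah: "a 0 = h"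
    using o e.e_nil d.e_nil by (simp_all add: a_def b_def Zero_Cmp[of Q Y Y] Cmp_Zero[of X X Q] Idn_Cmp del: Group.nat_pow_Suc d.nat_pow_Suc)
  have b\<alpha>: "b k \<cdot> \<alpha> = (if k = m then Idn C Q else Zero C Q Q)" if "k \<le> m" for k
    using free that by (simp add: free_on_def b_def)
  define f where "f = finprod (hom_group C X Y) (\<lambda>j. a j \<cdot> b (m - j)) {..m}"
  have f_in: "f \<in> Hom C X Y" using XY.finprod_closed[of "\<lambda>j. a j \<cdot> b (m - j)" "{..m}"] by (simp add: f_def)
  have "d \<cdot> f = finprod (hom_group C X Y) (\<lambda>j. d \<cdot> (a j \<cdot> b (m - j))) {..m}"
    unfolding f_def using o by (intro Cmp_finprod) auto
  also have "(\<lambda>j. d \<cdot> (a j \<cdot> b (m - j))) = (\<lambda>j. a (Suc j) \<cdot> b (m - j))"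
    using o a_in b_in by (simp add: Cmp_assoc[of X Q Y Y, symmetric] da)
  also have "finprod (hom_group C X Y) (\<lambda>j. a (Suc j) \<cdot> b (m - j)) {..m}
      = finprod (hom_group C X Y) (\<lambda>j. a j \<cdot> b (Suc m - j)) {..Suc m}"
    using a0 b0 o b_in a_in XY.finprod_closed[of "\<lambda>j. a (Suc j) \<cdot> b (m - j)" "{..m}"] XY.r_one
    by (subst XY.finprod_Suc2) (auto simp: Cmp_Zero[of X Q Y])
  also have "\<dots> = finprod (hom_group C X Y) (\<lambda>j. a j \<cdot> b (Suc m - j)) {..m}"
    using a0 o b_in XY.finprod_closed[of "\<lambda>j. a j \<cdot> b (Suc m - j)" "{..m}"] XY.l_one
    by (subst XY.finprod_Suc) (auto simp: Zero_Cmp[of X Q Y])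
  also have "\<dots> = finprod (hom_group C X Y) (\<lambda>j. a j \<cdot> b (m - j) \<cdot> e) {..m}"
    using o a_in b_in by (intro XY.finprod_cong') (auto simp: Cmp_assoc[of X X Q Y] be Suc_diff_le)
  also have "\<dots> = f \<cdot> e"
    unfolding f_def using o by (intro finprod_Cmp[symmetric]) auto
  finally have "f \<in> Hom (nil_category C (Suc m)) P R" using f_in by simp
  moreover have "f \<cdot> \<alpha> = h"
  proof -
    have "f \<cdot> \<alpha> = finprod (hom_group C Q Y) (\<lambda>j. a j \<cdot> b (m - j) \<cdot> \<alpha>) {..m}"
      unfolding f_def using o by (intro finprod_Cmp) auto
    also have "\<dots> = finprod (hom_group C Q Y) (\<lambda>j. if 0 = j then h else Zero C Q Y) {..m}"
      using o a_in b_in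
      by (intro QY.finprod_cong') (auto simp: Cmp_assoc[of Q X Q Y] b\<alpha> Cmp_Zero[of Q Q Y] Cmp_Idn ah Zero_in)
    also have "\<dots> = h" using QY.finprod_singleton[of 0 "{..m}" "\<lambda>_. h", unfolded hom_group_simps] o by simp
    finally show ?thesis .
  qed
  ultimately show ?thesis by (rule that)
qed

text \<open>Extending each of \<open>\<alpha>\<close>, \<open>\<alpha>'\<close> along the other gives mutually inverse morphisms by uniqueness.\<close>

lemma free_on_isomorphic:
  assumes free: "free_on C m P Q \<alpha> \<beta>" "free_on C m P' Q \<alpha>' \<beta>'"
  shows "isomorphic (nil_category C (Suc m)) P P'"
proof -
  interpret N: preadditive_category "nil_category C (Suc m)" by (rule preadditive_nil_category)
  let ?N = "nil_category C (Suc m)"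
  have P: "P \<in> Obj ?N" "P' \<in> Obj ?N" "Q \<in> Obj C" and a: "\<alpha> \<in> Hom C Q (fst P)" "\<alpha>' \<in> Hom C Q (fst P')"
    using free unfolding free_on_def by blast+
  obtain f where f: "f \<in> Hom ?N P P'" "f \<cdot> \<alpha> = \<alpha>'" using free_on_extend[OF free(1) P(2) a(2)] .
  obtain g where g: "g \<in> Hom ?N P' P" "g \<cdot> \<alpha>' = \<alpha>" using free_on_extend[OF free(2) P(1) a(1)] .
  have o: "fst P \<in> Obj C" "fst P' \<in> Obj C" "f \<in> Hom C (fst P) (fst P')" "g \<in> Hom C (fst P') (fst P)"
    using P f g by simp_all
  have "g \<cdot> f \<in> Hom ?N P P" "f \<cdot> g \<in> Hom ?N P' P'"
    using N.Cmp_in[OF P(1,2,1) f(1) g(1)] N.Cmp_in[OF P(2,1,2) g(1) f(1)] by (simp_all only: nil_category_simps(4))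
  moreover have "(g \<cdot> f) \<cdot> \<alpha> = Idn C (fst P) \<cdot> \<alpha>" "(f \<cdot> g) \<cdot> \<alpha>' = Idn C (fst P') \<cdot> \<alpha>'"
    using o P(3) a f(2) g(2)
    by (simp_all add: Cmp_assoc[of Q "fst P" "fst P'" "fst P"] Cmp_assoc[of Q "fst P'" "fst P" "fst P'"] Idn_Cmp[of Q])
  ultimately have "g \<cdot> f = Idn C (fst P)" "f \<cdot> g = Idn C (fst P')"
    using free_on_unique[OF free(1) P(1)] free_on_unique[OF free(2) P(2)] N.Idn_in P by (metis nil_category_simps(3))+
  then have "is_iso ?N P P' f" unfolding is_iso_def nil_category_simps(3,4) using f(1) g(1) by blast
  then show ?thesis using P unfolding isomorphic_def by blast
qed

lemma free_on_transport:
  assumes free: "free_on C m P Q \<alpha> \<beta>" and iso: "isomorphic (nil_category C (Suc m)) P' P"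
  shows "\<exists>\<alpha>' \<beta>'. free_on C m P' Q \<alpha>' \<beta>'"
proof -
  let ?N = "nil_category C (Suc m)"
  from iso obtain f g where P': "P' \<in> Obj ?N" "P \<in> Obj ?N" and fg: "f \<in> Hom ?N P' P" "g \<in> Hom ?N P P'"
    "g \<cdot> f = Idn C (fst P')" "f \<cdot> g = Idn C (fst P)"
    unfolding isomorphic_def is_iso_def nil_category_simps(3,4) by blast
  obtain X e Y d where P [simp]: "P = (X, e)" and R' [simp]: "P' = (Y, d)" by (cases P, cases P')
  have o: "X \<in> Obj C" "Y \<in> Obj C" "Q \<in> Obj C" "e \<in> Hom C X X" "d \<in> Hom C Y Y" "\<alpha> \<in> Hom C Q X" "\<beta> \<in> Hom C X Q"
    "f \<in> Hom C Y X" "g \<in> Hom C X Y" "f \<cdot> d = e \<cdot> f" "g \<cdot> e = d \<cdot> g" "g \<cdot> f = Idn C Y" "f \<cdot> g = Idn C X"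
    using free P' fg by (auto simp: free_on_def)
  let ?e = "\<lambda>k::nat. e [^]\<^bsub>End_ring C X\<^esub> k" and ?d = "\<lambda>k::nat. d [^]\<^bsub>End_ring C Y\<^esub> k"
  have pw: "?e k \<in> Hom C X X" "?d k \<in> Hom C Y Y" for k using o by (auto intro: pow_in)
  have ab: "\<alpha> \<cdot> \<beta> \<in> Hom C X X" using o by (intro Cmp_in[of X Q X])
  have i: "g \<cdot> \<alpha> \<in> Hom C Q Y" "\<beta> \<cdot> f \<in> Hom C Y Q" 
    using o by (auto intro: Cmp_in[of Q X Y] Cmp_in[of Y X Q])
  have gab: "(g \<cdot> \<alpha>) \<cdot> (\<beta> \<cdot> f) = g \<cdot> ((\<alpha> \<cdot> \<beta>) \<cdot> f)"
    using o i by (simp add: Cmp_assoc[of Y Q X Y] Cmp_assoc[of Y X Q X])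
  have fd: "f \<cdot> ?d k = ?e k \<cdot> f" for k using commute_pow[of Y X d e f k] o by simp
  have conj: "g \<cdot> (?e k \<cdot> f) = ?d k" for k
  proof -
    have "g \<cdot> (?e k \<cdot> f) = (g \<cdot> f) \<cdot> ?d k" unfolding fd[symmetric] using o pw by (intro Cmp_assoc[of Y Y X Y, symmetric])
    then show ?thesis using o pw by (simp add: Idn_Cmp[of Y Y])
  qed
  have \<beta>\<alpha>: "(\<beta> \<cdot> f) \<cdot> ?d k \<cdot> (g \<cdot> \<alpha>) = \<beta> \<cdot> ?e k \<cdot> \<alpha>" for k
  proof -
    have "(\<beta> \<cdot> f) \<cdot> ?d k \<cdot> (g \<cdot> \<alpha>) = (\<beta> \<cdot> (?e k \<cdot> f)) \<cdot> (g \<cdot> \<alpha>)"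
      using o pw fd by (simp add: Cmp_assoc[of Y Y X Q])
    also have "\<dots> = (\<beta> \<cdot> ?e k) \<cdot> (f \<cdot> (g \<cdot> \<alpha>))"
      using o pw i Cmp_in[of X X Q "?e k" \<beta>] by (simp add: Cmp_assoc[of Y X X Q, symmetric] Cmp_assoc[of Q Y X Q])
    also have "f \<cdot> (g \<cdot> \<alpha>) = \<alpha>" using o by (simp add: Cmp_assoc[of Q X Y X, symmetric] Idn_Cmp)
    finally show ?thesis .
  qed
  have "transfer_sum (End_ring C Y) d m ((g \<cdot> \<alpha>) \<cdot> (\<beta> \<cdot> f))
      = finprod (hom_group C Y Y) (\<lambda>j. g \<cdot> ((?e j \<cdot> (\<alpha> \<cdot> \<beta>) \<cdot> ?e (m - j)) \<cdot> f)) {..m}"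
  proof -
    have "?d j \<cdot> (g \<cdot> ((\<alpha> \<cdot> \<beta>) \<cdot> f)) \<cdot> ?d (m - j) = g \<cdot> ((?e j \<cdot> (\<alpha> \<cdot> \<beta>) \<cdot> ?e (m - j)) \<cdot> f)" for j
    proof -
      have i': "(\<alpha> \<cdot> \<beta>) \<cdot> f \<in> Hom C Y X" "?e j \<cdot> (\<alpha> \<cdot> \<beta>) \<in> Hom C X X" "g \<cdot> ?e j \<in> Hom C X Y"
        using o ab pw by (auto intro: Cmp_in[of Y X X] Cmp_in[of X X X] Cmp_in[of X X Y])
      have "?d j \<cdot> (g \<cdot> ((\<alpha> \<cdot> \<beta>) \<cdot> f)) \<cdot> ?d (m - j) = (g \<cdot> ?e j) \<cdot> ((\<alpha> \<cdot> \<beta>) \<cdot> f) \<cdot> ?d (m - j)"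
        using o pw i' commute_pow[of X Y e d g j] by (simp add: Cmp_assoc[of Y X Y Y])
      also have "\<dots> = (g \<cdot> ?e j) \<cdot> ((\<alpha> \<cdot> \<beta>) \<cdot> (f \<cdot> ?d (m - j)))"
        using o pw i' ab by (simp add: Cmp_assoc[of Y Y X Y] Cmp_assoc[of Y Y X X])
      also have "\<dots> = (g \<cdot> ?e j) \<cdot> (((\<alpha> \<cdot> \<beta>) \<cdot> ?e (m - j)) \<cdot> f)"
        using o pw i' ab fd by (simp add: Cmp_assoc[of Y X X X])
      also have "\<dots> = g \<cdot> ((?e j \<cdot> (\<alpha> \<cdot> \<beta>) \<cdot> ?e (m - j)) \<cdot> f)"
      proof -
        have cr: "(\<alpha> \<cdot> \<beta>) \<cdot> ?e (m - j) \<in> Hom C X X"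
          by (rule Cmp_in[of X X X]) (use o pw ab in simp_all)
        have "(g \<cdot> ?e j) \<cdot> (((\<alpha> \<cdot> \<beta>) \<cdot> ?e (m - j)) \<cdot> f) = g \<cdot> (?e j \<cdot> (((\<alpha> \<cdot> \<beta>) \<cdot> ?e (m - j)) \<cdot> f))"
          using o pw cr by (intro Cmp_assoc[of Y X X Y] Cmp_in[of Y X X])
        also have "?e j \<cdot> (((\<alpha> \<cdot> \<beta>) \<cdot> ?e (m - j)) \<cdot> f) = (?e j \<cdot> ((\<alpha> \<cdot> \<beta>) \<cdot> ?e (m - j))) \<cdot> f"
          using o pw cr by (intro Cmp_assoc[of Y X X X, symmetric])
        also have "?e j \<cdot> ((\<alpha> \<cdot> \<beta>) \<cdot> ?e (m - j)) = ?e j \<cdot> (\<alpha> \<cdot> \<beta>) \<cdot> ?e (m - j)"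
          by (rule Cmp_assoc[of X X X X, symmetric]) (use o pw ab in simp_all)
        finally show ?thesis .
      qed
      finally show ?thesis .
    qed
    then show ?thesis by (simp add: transfer_sum_End_ring gab)
  qed
  also have "\<dots> = g \<cdot> (finprod (hom_group C X X) (\<lambda>j. ?e j \<cdot> (\<alpha> \<cdot> \<beta>) \<cdot> ?e (m - j)) {..m} \<cdot> f)"
  proof -
    have t: "?e j \<cdot> (\<alpha> \<cdot> \<beta>) \<cdot> ?e (m - j) \<in> Hom C X X" for j
      using o ab pw Cmp_in[of X X X "\<alpha> \<cdot> \<beta>" "?e j"] by (intro Cmp_in[of X X X "?e (m - j)"]) auto
    then have "?e j \<cdot> (\<alpha> \<cdot> \<beta>) \<cdot> ?e (m - j) \<cdot> f \<in> Hom C Y X" for j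
      using o by (intro Cmp_in[of Y X X])
    with t show ?thesis using o by (simp add: finprod_Cmp[of Y X X] Cmp_finprod[of Y X Y])
  qed
  also have "\<dots> = Idn C Y" using free o by (simp add: free_on_def transfer_sum_End_ring Idn_Cmp)
  finally have "free_on C m P' Q (g \<cdot> \<alpha>) (\<beta> \<cdot> f)"
    using P' o i free \<beta>\<alpha> by (simp add: free_on_def)
  then show ?thesis by blast
qed

end

context additive_category
begin

lemma is_biproduct_power:
  assumes "X \<in> Obj C"
  shows "is_biproduct C n (\<lambda>_. X) (power_obj C n X) (power_incl C n X) (power_proj C n X)"
proof -
  let ?P = "\<lambda>(B, \<iota>, \<pi>). is_biproduct C n (\<lambda>_. X) B \<iota> \<pi>"
  have "\<exists>x. ?P x" using biproducts[of n "\<lambda>_. X"] assms by auto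
  then have "?P (power_data C n X)" unfolding power_data_def by (rule someI_ex)
  then show ?thesis by (simp add: power_obj_def power_incl_def power_proj_def split: prod.splits)
qed

text \<open>The shift \<open>e\<close> sends \<open>\<iota>\<^sub>k\<close> to \<open>\<iota>\<^bsub>k+1\<^esub>\<close> and \<open>\<pi>\<^bsub>k+1\<^esub>\<close> to \<open>\<pi>\<^sub>k\<close>, so \<open>\<alpha> = \<iota>\<^sub>1\<close> and \<open>\<beta> = \<pi>\<^bsub>m+1\<^esub>\<close> generate all
  inclusions and projections.\<close>

lemma T_obj_free:
  assumes X: "X \<in> Obj C"
  shows "free_on C m (T_obj C (Suc m) X) X (power_incl C (Suc m) X 1) (power_proj C (Suc m) X (Suc m))"
proof -
  define n where "n = Suc m"
  let ?B = "power_obj C n X"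
  define \<iota> where "\<iota> = power_incl C n X"
  define \<pi> where "\<pi> = power_proj C n X"
  have B: "?B \<in> Obj C" and \<iota>: "\<And>i. i \<in> {1..n} \<Longrightarrow> \<iota> i \<in> Hom C X ?B" and \<pi>: "\<And>i. i \<in> {1..n} \<Longrightarrow> \<pi> i \<in> Hom C ?B X"
    and \<pi>\<iota>: "\<And>i j. i \<in> {1..n} \<Longrightarrow> j \<in> {1..n} \<Longrightarrow> \<pi> i \<cdot> \<iota> j = (if i = j then Idn C X else Zero C X X)"
    and \<iota>\<pi>: "finprod (hom_group C ?B ?B) (\<lambda>i. \<iota> i \<cdot> \<pi> i) {1..n} = Idn C ?B"
    using is_biproduct_power[OF X, of n] unfolding is_biproduct_def \<iota>_def \<pi>_def by blast+
  interpret XB: comm_group "hom_group C X ?B" using X B by (intro hom_comm_group)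
  interpret BX: comm_group "hom_group C ?B X" using X B by (intro hom_comm_group)
  interpret BB: comm_group "hom_group C ?B ?B" using B by (intro hom_comm_group)
  define e where "e = snd (T_obj C n X)"
  let ?t = "\<lambda>(i, j). (\<iota> i \<cdot> (if i = j + 1 then Idn C X else Zero C X X)) \<cdot> \<pi> j"
  let ?I = "{1..n} \<times> {1..n}"
  have e: "e = finprod (hom_group C ?B ?B) ?t ?I"
    by (simp add: e_def T_obj_def matrix_mor_def \<iota>_def \<pi>_def)
  have A: "(if i = j + 1 then Idn C X else Zero C X X) \<in> Hom C X X" for i j :: nat
    using X by (simp add: Idn_in Zero_in)
  have t: "?t \<in> ?I \<rightarrow> Hom C ?B ?B"
    using X B \<iota> \<pi> A by (auto intro!: Cmp_in[of ?B X ?B] Cmp_in[of X X ?B])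
  have e_in: "e \<in> Hom C ?B ?B" unfolding e using t BB.finprod_closed[of ?t ?I] by simp
  have e\<iota>: "e \<cdot> \<iota> k = (if k < n then \<iota> (Suc k) else Zero C X ?B)" if k: "k \<in> {1..n}" for k
  proof -
    have "e \<cdot> \<iota> k = finprod (hom_group C X ?B) (\<lambda>p. ?t p \<cdot> \<iota> k) ?I"
      unfolding e using X B \<iota> k t by (intro finprod_Cmp) auto
    also have "\<dots> = finprod (hom_group C X ?B) (\<lambda>p. if (Suc k, k) = p then \<iota> (Suc k) else Zero C X ?B) ?I"
    proof (intro XB.finprod_cong')
      fix p assume p: "p \<in> ?I"
      obtain i j where [simp]: "p = (i, j)" by (cases p)
      have ij: "i \<in> {1..n}" "j \<in> {1..n}" using p by auto
      have "?t p \<cdot> \<iota> k = (\<iota> i \<cdot> (if i = j + 1 then Idn C X else Zero C X X)) \<cdot> (\<pi> j \<cdot> \<iota> k)"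
        using X B \<iota>[OF ij(1)] \<pi>[OF ij(2)] \<iota>[OF k] A Cmp_in[of X X ?B _ "\<iota> i"]
        by (simp add: Cmp_assoc[of X ?B X ?B])
      then show "?t p \<cdot> \<iota> k = (if (Suc k, k) = p then \<iota> (Suc k) else Zero C X ?B)"
        using X B \<iota>[OF ij(1)] k ij
        by (auto simp: \<pi>\<iota> Cmp_Idn Cmp_Zero[of X X ?B] Zero_in Idn_in)
    qed (use \<iota> X B in \<open>auto simp: Zero_in\<close>)
    also have "\<dots> = (if k < n then \<iota> (Suc k) else Zero C X ?B)"
    proof (cases "k < n")
      case True
      then show ?thesis
        using XB.finprod_singleton[of "(Suc k, k)" ?I "\<lambda>_. \<iota> (Suc k)", unfolded hom_group_simps] k \<iota>[of "Suc k"]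
        by (simp add: Pi_iff)
    next
      case False
      then have "finprod (hom_group C X ?B) (\<lambda>p. if (Suc k, k) = p then \<iota> (Suc k) else Zero C X ?B) ?I
          = Zero C X ?B"
        by (intro XB.finprod_one_eqI[unfolded hom_group_simps]) auto
      then show ?thesis using False by simp
    qed
    finally show ?thesis .
  qed
  have \<pi>e: "\<pi> (Suc k) \<cdot> e = \<pi> k" if k: "k \<in> {1..m}" for k
  proof -
    have k': "Suc k \<in> {1..n}" "k \<in> {1..n}" using k by (auto simp: n_def)
    have "\<pi> (Suc k) \<cdot> e = finprod (hom_group C ?B X) (\<lambda>p. \<pi> (Suc k) \<cdot> ?t p) ?I"
      unfolding e using X B \<pi> k' t by (intro Cmp_finprod) auto
    also have "\<dots> = finprod (hom_group C ?B X) (\<lambda>p. if (Suc k, k) = p then \<pi> k else Zero C ?B X) ?I"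
    proof (intro BX.finprod_cong')
      fix p assume p: "p \<in> ?I"
      obtain i j where [simp]: "p = (i, j)" by (cases p)
      have ij: "i \<in> {1..n}" "j \<in> {1..n}" using p by auto
      have "\<pi> (Suc k) \<cdot> ?t p = (\<pi> (Suc k) \<cdot> (\<iota> i \<cdot> (if i = j + 1 then Idn C X else Zero C X X))) \<cdot> \<pi> j"
        using X B \<iota>[OF ij(1)] \<pi>[OF ij(2)] \<pi>[OF k'(1)] A Cmp_in[of X X ?B _ "\<iota> i"]
        by (simp add: Cmp_assoc[of ?B X ?B X])
      also have "\<dots> = ((\<pi> (Suc k) \<cdot> \<iota> i) \<cdot> (if i = j + 1 then Idn C X else Zero C X X)) \<cdot> \<pi> j"
        using X B \<iota>[OF ij(1)] \<pi>[OF k'(1)] A by (simp add: Cmp_assoc[of X X ?B X])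
      finally show "\<pi> (Suc k) \<cdot> ?t p = (if (Suc k, k) = p then \<pi> k else Zero C ?B X)"
        using X B \<pi>[OF ij(2)] k' ij
        by (auto simp: \<pi>\<iota> Idn_Cmp[of _ X] Zero_Cmp[of _ X X] Cmp_Zero[of X X X] Zero_in Idn_in)
    qed (use \<pi> k' X B in \<open>auto simp: Zero_in\<close>)
    also have "\<dots> = \<pi> k"
      using BX.finprod_singleton[of "(Suc k, k)" ?I "\<lambda>_. \<pi> k", unfolded hom_group_simps] k' \<pi>[of k]
      by (simp add: Pi_iff)
    finally show ?thesis .
  qed
  let ?e = "\<lambda>k::nat. e [^]\<^bsub>End_ring C ?B\<^esub> k"
  have pw: "?e k \<in> Hom C ?B ?B" for k using B e_in by (rule pow_in)
  have pow\<iota>: "?e j \<cdot> \<iota> i = (if i + j \<le> n then \<iota> (i + j) else Zero C X ?B)" if "i \<in> {1..n}" for i j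
    using that
  proof (induction j arbitrary: i)
    case 0
    then show ?case using X B \<iota> by (simp add: Idn_Cmp[of X])
  next
    case (Suc j)
    have "?e (Suc j) \<cdot> \<iota> i = ?e j \<cdot> (e \<cdot> \<iota> i)"
      using X B \<iota>[OF Suc.prems] e_in pw by (simp add: Cmp_assoc[of X ?B ?B ?B])
    then show ?case using X B pw Suc.IH[of "Suc i"] Suc.prems
      by (auto simp: e\<iota> Cmp_Zero[of X ?B ?B])
  qed
  have one: "(1::nat) \<in> {1..n}" "n \<in> {1..n}" by (auto simp: n_def)
  have \<pi>pow: "\<pi> n \<cdot> ?e j = \<pi> (n - j)" if "j \<le> m" for j
    using that
  proof (induction j)
    case 0
    then show ?case using X B \<pi>[OF one(2)] by (simp add: Cmp_Idn[of ?B X])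
  next
    case (Suc j)
    have "\<pi> n \<cdot> ?e (Suc j) = (\<pi> n \<cdot> ?e j) \<cdot> e"
      using X B \<pi>[OF one(2)] e_in pw by (simp add: Cmp_assoc[of ?B ?B ?B X])
    also have "\<dots> = \<pi> (Suc (n - Suc j)) \<cdot> e" using Suc by (simp add: n_def Suc_diff_le)
    also have "\<dots> = \<pi> (n - Suc j)" using Suc by (intro \<pi>e) (auto simp: n_def)
    finally show ?case .
  qed
  \<comment> \<open>Nilpotency can be tested on the inclusions, as they are jointly epic.\<close>
  have e_nil: "?e n = Zero C ?B ?B"
  proof -
    have "?e n = ?e n \<cdot> finprod (hom_group C ?B ?B) (\<lambda>i. \<iota> i \<cdot> \<pi> i) {1..n}"
      unfolding \<iota>\<pi> using B pw by (simp add: Cmp_Idn[of ?B ?B])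
    also have "\<dots> = finprod (hom_group C ?B ?B) (\<lambda>i. ?e n \<cdot> (\<iota> i \<cdot> \<pi> i)) {1..n}"
      using X B pw \<iota> \<pi> by (intro Cmp_finprod) (auto intro: Cmp_in[of ?B X ?B])
    also have "\<dots> = Zero C ?B ?B"
    proof (rule BB.finprod_one_eqI[unfolded hom_group_simps])
      fix i assume i: "i \<in> {1..n}"
      then show "?e n \<cdot> (\<iota> i \<cdot> \<pi> i) = Zero C ?B ?B"
        using X B pw \<iota>[OF i] \<pi>[OF i] pow\<iota>[OF i, of n]
        by (simp add: Cmp_assoc[of ?B X ?B ?B, symmetric] Zero_Cmp[of ?B X])
    qed
    finally show ?thesis .
  qed
  have \<iota>\<pi>_in: "\<iota> (Suc j) \<cdot> \<pi> (Suc j) \<in> Hom C ?B ?B" if "j \<le> m" for j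
  proof -
    have "Suc j \<in> {1..n}" using that by (simp add: n_def)
    then show ?thesis using X B \<iota> \<pi> by (intro Cmp_in[of ?B X ?B])
  qed
  have tr: "transfer_sum (End_ring C ?B) e m (\<iota> 1 \<cdot> \<pi> n) = Idn C ?B"
  proof -
    have "transfer_sum (End_ring C ?B) e m (\<iota> 1 \<cdot> \<pi> n)
        = finprod (hom_group C ?B ?B) (\<lambda>j. \<iota> (Suc j) \<cdot> \<pi> (Suc j)) {..m}"
      unfolding transfer_sum_End_ring
    proof (intro BB.finprod_cong')
      fix j assume j: "j \<in> {..m}"
      have "?e j \<cdot> (\<iota> 1 \<cdot> \<pi> n) \<cdot> ?e (m - j) = (?e j \<cdot> \<iota> 1) \<cdot> (\<pi> n \<cdot> ?e (m - j))"
        using X B pw \<iota>[OF one(1)] \<pi>[OF one(2)] Cmp_in[of X ?B ?B "\<iota> 1" "?e j"]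
        by (simp add: Cmp_assoc[of ?B X ?B ?B, symmetric] Cmp_assoc[of ?B ?B X ?B])
      also have "\<dots> = \<iota> (Suc j) \<cdot> \<pi> (Suc j)"
        using j pow\<iota>[OF one(1), of j] \<pi>pow[of "m - j"] by (simp add: n_def Suc_diff_le)
      finally show "?e j \<cdot> (\<iota> 1 \<cdot> \<pi> n) \<cdot> ?e (m - j) = \<iota> (Suc j) \<cdot> \<pi> (Suc j)" .
    qed (use \<iota>\<pi>_in in auto)
    also have "\<dots> = finprod (hom_group C ?B ?B) (\<lambda>i. \<iota> i \<cdot> \<pi> i) (Suc ` {..m})"
      using \<iota>\<pi>_in by (intro BB.finprod_reindex[symmetric]) auto
    also have "Suc ` {..m} = {1..n}" by (simp add: n_def image_Suc_atMost)
    finally show ?thesis using \<iota>\<pi> by simp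
  qed
  have T: "T_obj C n X = (?B, e)" by (simp add: e_def T_obj_def)
  have "\<pi> n \<cdot> ?e k \<cdot> \<iota> 1 = (if k = m then Idn C X else Zero C X X)" if "k \<le> m" for k
    using that \<pi>pow[OF that] \<pi>\<iota>[of "n - k" 1] by (auto simp: n_def)
  then have "free_on C m (T_obj C n X) X (\<iota> 1) (\<pi> n)"
    using X B e_in e_nil \<iota>[OF one(1)] \<pi>[OF one(2)] tr unfolding free_on_def T by (simp add: n_def)
  then show ?thesis by (simp add: \<iota>_def \<pi>_def n_def)
qed

end

section \<open>Projective objects\<close>

context exact_category
begin

lemma E_dest:
  assumes "(X, f, Y, g, Z) \<in> E"
  shows "X \<in> Obj C" "Y \<in> Obj C" "Z \<in> Obj C" "f \<in> Hom C X Y" "g \<in> Hom C Y Z"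
    "is_kernel C X f Y g Z" "is_cokernel C X f Y g Z"
  using E_kernel_cokernel assms by (auto simp: kernel_cokernel_pairs_def composable_pairs_def)

text \<open>The complementary idempotent \<open>d = 1 - s c\<close> splits, and its image is the other summand of \<open>B\<close>.\<close>

lemma split_epic_complement:
  assumes idc: "idempotent_complete C" and o: "B \<in> Obj C" "X \<in> Obj C"
    and c: "c \<in> Hom C B X" and s: "s \<in> Hom C X B" and cs: "c \<cdot> s = Idn C X"
  obtains K \<rho> \<kappa> where "K \<in> Obj C" "\<rho> \<in> Hom C B K" "\<kappa> \<in> Hom C K B" "\<rho> \<cdot> \<kappa> = Idn C K"
    "(s \<cdot> c) \<boxplus> (\<kappa> \<cdot> \<rho>) = Idn C B" "c \<cdot> \<kappa> = Zero C K X" "\<rho> \<cdot> s = Zero C X K"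
proof -
  interpret R: ring "End_ring C B" using o by (intro ring_End_ring)
  let ?p = "s \<cdot> c"
  define d where "d = Idn C B \<ominus>\<^bsub>End_ring C B\<^esub> ?p"
  have p: "?p \<in> Hom C B B" using o c s by (intro Cmp_in[of B X B])
  have "?p \<cdot> ?p = s \<cdot> (c \<cdot> ?p)" using o c s p by (simp add: Cmp_assoc[of B B X B])
  also have "c \<cdot> ?p = c" using o c s by (simp add: Cmp_assoc[of B X B X, symmetric] cs Idn_Cmp[of B X])
  finally have pp: "?p \<cdot> ?p = ?p" .
  have d: "d \<in> Hom C B B" using R.minus_closed[of "Idn C B" ?p] p Idn_in o by (simp add: d_def)
  have pd: "?p \<boxplus> d = Idn C B"
    using R.minus_closed[of "Idn C B" ?p] R.minus_eq[of "Idn C B" ?p] R.a_lcomm[of ?p "Idn C B" "\<ominus>\<^bsub>End_ring C B\<^esub> ?p"]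
      R.r_neg[of ?p] R.a_inv_closed[of ?p] R.r_zero[of "Idn C B"] p Idn_in[OF o(1)] by (simp add: d_def)
  interpret BB: comm_group "hom_group C B B" using o by (intro hom_comm_group)
  have absorb: "y = Zero C Y Z" if "Y \<in> Obj C" "Z \<in> Obj C" "x \<in> Hom C Y Z" "y \<in> Hom C Y Z" "x \<boxplus> y = x" for x y Y Z
    using group.l_cancel_one[of "hom_group C Y Z" x y] hom_comm_group[of Y Z] that
    by (simp add: comm_group_def)
  have pd0: "?p \<cdot> d = Zero C B B" and dp0: "d \<cdot> ?p = Zero C B B"
  proof -
    have "?p \<boxplus> (?p \<cdot> d) = ?p \<cdot> (?p \<boxplus> d)" using o p d by (simp add: Cmp_Add_right[of B B B] pp)
    then have "?p \<boxplus> (?p \<cdot> d) = ?p" using o p by (simp add: pd Cmp_Idn[of B B])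
    then show "?p \<cdot> d = Zero C B B" using o p d by (intro absorb) (auto intro: Cmp_in[of B B B])
    have "?p \<boxplus> (d \<cdot> ?p) = (?p \<boxplus> d) \<cdot> ?p" using o p d by (simp add: Cmp_Add_left[of B B B] pp)
    then have "?p \<boxplus> (d \<cdot> ?p) = ?p" using o p by (simp add: pd Idn_Cmp[of B B])
    then show "d \<cdot> ?p = Zero C B B" using o p d by (intro absorb) (auto intro: Cmp_in[of B B B])
  qed
  have cd: "c \<cdot> d = Zero C B X"
  proof -
    have "c \<cdot> d = (c \<cdot> s) \<cdot> (c \<cdot> d)" using o c d Cmp_in[of B B X] by (simp add: cs Idn_Cmp[of B X])
    also have "\<dots> = c \<cdot> (?p \<cdot> d)"
      using o c s d Cmp_in[of B B X d c] by (simp add: Cmp_assoc[of B X B X] Cmp_assoc[of B B X B])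
    finally show ?thesis using o c by (simp add: pd0 Cmp_Zero[of B B X])
  qed
  have ds: "d \<cdot> s = Zero C X B"
  proof -
    have "d \<cdot> s = (d \<cdot> s) \<cdot> (c \<cdot> s)" using o s d Cmp_in[of X B B] by (simp add: cs Cmp_Idn[of X B])
    also have "\<dots> = (d \<cdot> ?p) \<cdot> s"
      using o c s d p Cmp_in[of B X B c s] by (simp add: Cmp_assoc[of X B X B, symmetric] Cmp_assoc[of B X B B] Cmp_in[of X B B])
    finally show ?thesis using o s by (simp add: dp0 Zero_Cmp[of X B B])
  qed
  have "d \<cdot> d = (?p \<boxplus> d) \<cdot> d"
    using o p d BB.l_one[of "d \<cdot> d"] by (simp add: Cmp_Add_left[of B B B] pd0 Cmp_in[of B B B])
  then have dd: "d \<cdot> d = d" using o d by (simp add: pd Idn_Cmp[of B B])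
  obtain K \<rho> \<kappa> where K: "K \<in> Obj C" "\<rho> \<in> Hom C B K" "\<kappa> \<in> Hom C K B" "d = \<kappa> \<cdot> \<rho>" "\<rho> \<cdot> \<kappa> = Idn C K"
    using idc o(1) d dd unfolding idempotent_complete_def by metis
  have "(c \<cdot> (\<kappa> \<cdot> \<rho>)) \<cdot> \<kappa> = c \<cdot> \<kappa>"
    using K(1-3,5) o c Cmp_in[of B K B \<rho> \<kappa>]
    by (simp add: Cmp_assoc[of K B B X] Cmp_assoc[of K B K B] Cmp_Idn[of K B])
  then have 1: "c \<cdot> \<kappa> = Zero C K X" using K(1-3) o by (simp add: cd[unfolded K(4)] Zero_Cmp[of K B X])
  have "\<rho> \<cdot> ((\<kappa> \<cdot> \<rho>) \<cdot> s) = \<rho> \<cdot> s"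
    using K(1-3,5) o s Cmp_in[of X B K s \<rho>]
    by (simp add: Cmp_assoc[of X B K B] Cmp_assoc[of X K B K, symmetric] Idn_Cmp[of X K])
  then have 2: "\<rho> \<cdot> s = Zero C X K" using K(1-3) o by (simp add: ds[unfolded K(4)] Cmp_Zero[of X B K])
  show ?thesis using that[OF K(1,2,3,5) pd[unfolded K(4)] 1 2] .
qed

text \<open>With \<open>B \<cong> X \<oplus> K\<close>, the morphism \<open>c\<close> is the projection of a product. The cokernel \<open>K \<rightarrow> Z\<close> of \<open>1\<^sub>K\<close>
  is an admissible epic to a zero object, and its pull-back along \<open>X \<rightarrow> Z\<close> is the projection of the
  product of \<open>X\<close> and \<open>K\<close> to \<open>X\<close>, so that one is admissible as well.\<close>

lemma split_epic_admissible:
  assumes idc: "idempotent_complete C" and o: "B \<in> Obj C" "X \<in> Obj C"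
    and c: "c \<in> Hom C B X" and s: "s \<in> Hom C X B" and cs: "c \<cdot> s = Idn C X"
  shows "admissible_epic E B c X"
proof -
  obtain K \<rho> \<kappa> where K: "K \<in> Obj C" "\<rho> \<in> Hom C B K" "\<kappa> \<in> Hom C K B" "\<rho> \<cdot> \<kappa> = Idn C K"
    and split: "(s \<cdot> c) \<boxplus> (\<kappa> \<cdot> \<rho>) = Idn C B" and c\<kappa>: "c \<cdot> \<kappa> = Zero C K X" and \<rho>s: "\<rho> \<cdot> s = Zero C X K"
    using split_epic_complement[OF assms] .
  obtain z Z where zE: "(K, Idn C K, K, z, Z) \<in> E"
    using Idn_monic[OF K(1)] unfolding admissible_monic_def by blast
  note z = E_dest[OF zE]
  \<comment> \<open>So every square over \<open>Z\<close> commutes and the pull-back is a product.\<close>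
  have z0: "z = Zero C K Z" using z(7) Cmp_Idn[OF K(1) z(3,5)] by (simp add: is_cokernel_def)
  have Zero_Cmp_to_Z: "Zero C X Z \<cdot> u = z \<cdot> v" if "W \<in> Obj C" "u \<in> Hom C W X" "v \<in> Hom C W K" for W u v
    using that o z(3) K(1) by (simp add: z0 Zero_Cmp[of W X] Zero_Cmp[of W K])
  obtain Y g' c' where pb: "is_pullback C K z Z (Zero C X Z) X g' c' Y" and adm: "admissible_epic E Y g' X"
    using epic_pullback[of K z Z X "Zero C X Z"] zE o z(3) Zero_in unfolding admissible_epic_def by blast
  have Y: "Y \<in> Obj C" "g' \<in> Hom C Y X" "c' \<in> Hom C Y K"
    and univ: "\<And>W u v. W \<in> Obj C \<Longrightarrow> u \<in> Hom C W X \<Longrightarrow> v \<in> Hom C W K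
       \<Longrightarrow> \<exists>!k. k \<in> Hom C W Y \<and> g' \<cdot> k = u \<and> c' \<cdot> k = v"
    using pb Zero_Cmp_to_Z unfolding is_pullback_def by blast+
  obtain k where k: "k \<in> Hom C B Y" "g' \<cdot> k = c" "c' \<cdot> k = \<rho>"
    using univ[OF o(1) c K(2)] by blast
  define b where "b = (s \<cdot> g') \<boxplus> (\<kappa> \<cdot> c')"
  have sg: "s \<cdot> g' \<in> Hom C Y B" "\<kappa> \<cdot> c' \<in> Hom C Y B"
    using Y o K s by (auto intro: Cmp_in[of Y X B] Cmp_in[of Y K B])
  have b: "b \<in> Hom C Y B" using sg Y o by (simp add: b_def Add_in)
  have bk: "b \<cdot> k = Idn C B"
    using Y o K s k sg split by (simp add: b_def Cmp_Add_left[of B Y B] Cmp_assoc[of B Y X B] Cmp_assoc[of B Y K B])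
  interpret YX: comm_group "hom_group C Y X" using Y o by (intro hom_comm_group)
  interpret YK: comm_group "hom_group C Y K" using Y K by (intro hom_comm_group)
  have cb: "c \<cdot> b = g'"
    using Y o K s sg c YX.r_one[of g']
    by (simp add: b_def Cmp_Add_right[of Y B X] Cmp_assoc[of Y X B X, symmetric] Cmp_assoc[of Y K B X, symmetric]
        cs c\<kappa> Idn_Cmp[of Y X] Zero_Cmp[of Y K X])
  have \<rho>b: "\<rho> \<cdot> b = c'"
    using Y o K s sg YK.l_one[of c']
    by (simp add: b_def Cmp_Add_right[of Y B K] Cmp_assoc[of Y X B K, symmetric] Cmp_assoc[of Y K B K, symmetric]
        \<rho>s Idn_Cmp[of Y K] Zero_Cmp[of Y X K])
  have kb: "k \<cdot> b = Idn C Y"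
  proof -
    have "k \<cdot> b \<in> Hom C Y Y \<and> g' \<cdot> (k \<cdot> b) = g' \<and> c' \<cdot> (k \<cdot> b) = c'"
      using Y o K k b cb \<rho>b Cmp_in[of Y B Y b k]
      by (simp add: Cmp_assoc[of Y B Y X, symmetric] Cmp_assoc[of Y B Y K, symmetric])
    moreover have "Idn C Y \<in> Hom C Y Y \<and> g' \<cdot> Idn C Y = g' \<and> c' \<cdot> Idn C Y = c'"
      using Y o K by (simp add: Idn_in Cmp_Idn[of Y X] Cmp_Idn[of Y K])
    ultimately show ?thesis using univ[OF Y] by blast
  qed
  obtain L l where lE: "(L, l, Y, g', X) \<in> E" using adm unfolding admissible_epic_def by blast
  note l = E_dest[OF lE]
  have bl: "b \<cdot> l \<in> Hom C L B" using l b o by (intro Cmp_in[of L Y B])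
  have iso_Idn: "is_iso C W W (Idn C W)" if "W \<in> Obj C" for W
    using that Idn_in[OF that] Cmp_Idn[OF that that] by (auto simp: is_iso_def)
  have "(L, b \<cdot> l, B, c, X) \<in> E"
  proof (rule E_iso_closed[OF lE])
    show "(L, b \<cdot> l, B, c, X) \<in> composable_pairs C" using l o c bl by (simp add: composable_pairs_def)
    show "is_iso C L L (Idn C L)" "is_iso C X X (Idn C X)" using l o iso_Idn by auto
    show "is_iso C Y B b" using b k bk kb by (auto simp: is_iso_def)
    show "b \<cdot> l \<cdot> Idn C L = b \<cdot> l" using l o bl Cmp_Idn by blast
    show "c \<cdot> b = Idn C X \<cdot> g'" using Y o cb by (simp add: Idn_Cmp[of Y X])
  qed
  then show ?thesis unfolding admissible_epic_def by blast
qed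

text \<open>The factorization through the kernel in \<open>C\<close> commutes with the nilpotent endomorphisms because
  \<open>f\<close> is monic.\<close>

lemma forget_exact_kernel:
  assumes "(X, f, Y, g, Z) \<in> forget_exact C E n"
  shows "(X, f, Y, g, Z) \<in> composable_pairs (nil_category C n) \<and> is_kernel (nil_category C n) X f Y g Z"
proof -
  let ?N = "nil_category C n"
  have comp: "(X, f, Y, g, Z) \<in> composable_pairs ?N" and inE: "(fst X, f, fst Y, g, fst Z) \<in> E"
    using assms by (auto simp: forget_exact_def forget_obj_def forget_mor_def)
  note e = E_dest[OF inE]
  have o: "snd X \<in> Hom C (fst X) (fst X)" "snd Y \<in> Hom C (fst Y) (fst Y)" "f \<cdot> snd X = snd Y \<cdot> f"
    using comp by (auto simp: composable_pairs_def)
  have "\<exists>!k. k \<in> Hom ?N W X \<and> f \<cdot> k = h"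
    if W: "W \<in> Obj ?N" and h: "h \<in> Hom ?N W Y" and gh: "g \<cdot> h = Zero C (fst W) (fst Z)" for W h
  proof -
    have w: "fst W \<in> Obj C" "snd W \<in> Hom C (fst W) (fst W)" "h \<in> Hom C (fst W) (fst Y)" "h \<cdot> snd W = snd Y \<cdot> h"
      using W h by auto
    obtain k where k: "k \<in> Hom C (fst W) (fst X)" "f \<cdot> k = h"
      using e(6) w(1,3) gh unfolding is_kernel_def by blast
    have "f \<cdot> (k \<cdot> snd W) = (f \<cdot> k) \<cdot> snd W"
      using e w k(1) by (simp add: Cmp_assoc[of "fst W" "fst W" "fst X" "fst Y"])
    also have "\<dots> = snd Y \<cdot> (f \<cdot> k)" using w k(2) by simp
    also have "\<dots> = (f \<cdot> snd X) \<cdot> k"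
      using e w o k(1) by (simp add: Cmp_assoc[of "fst W" "fst X" "fst Y" "fst Y"])
    also have "\<dots> = f \<cdot> (snd X \<cdot> k)"
      using e w o(1) k(1) by (simp add: Cmp_assoc[of "fst W" "fst X" "fst X" "fst Y"])
    finally have "k \<cdot> snd W = snd X \<cdot> k"
      by (intro kernel_monic[OF e(6,1,2,3,4,5) w(1) Cmp_in[OF w(1,1) e(1) w(2) k(1)] Cmp_in[OF w(1) e(1,1) k(1) o(1)]])
    then have "k \<in> Hom ?N W X" using k by simp
    moreover have "k' = k" if "k' \<in> Hom ?N W X" "f \<cdot> k' = h" for k'
      using that k(2) by (intro kernel_monic[OF e(6,1,2,3,4,5) w(1) _ k(1)]) simp_all
    ultimately show ?thesis using k(2) by blast
  qed
  then have "is_kernel ?N X f Y g Z" using e(6) unfolding is_kernel_def nil_category_simps(4,6) by blast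
  with comp show ?thesis by blast
qed

text \<open>The endomorphism of the source restricts to the kernel of \<open>c\<close>, and the restriction is nilpotent
  because the kernel is monic.\<close>

lemma admissible_epic_forget_exact:
  assumes c: "admissible_epic E (fst P) c (fst R)" and P: "P \<in> Obj (nil_category C n)" and R: "R \<in> Obj (nil_category C n)"
    and cN: "c \<in> Hom (nil_category C n) P R"
  shows "admissible_epic (forget_exact C E n) P c R"
proof -
  obtain B e X d where P' [simp]: "P = (B, e)" and R' [simp]: "R = (X, d)" by (cases P, cases R)
  obtain L l where lE: "(L, l, B, c, X) \<in> E" using c unfolding admissible_epic_def by auto
  note l = E_dest[OF lE]
  have e: "e \<in> Hom C B B" "d \<in> Hom C X X" "c \<cdot> e = d \<cdot> c" "e [^]\<^bsub>End_ring C B\<^esub> n = Zero C B B"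
    using P R cN by auto
  have el: "e \<cdot> l \<in> Hom C L B" using l e by (intro Cmp_in[of L B B])
  have "c \<cdot> (e \<cdot> l) = d \<cdot> (c \<cdot> l)"
    using l(1-5) e by (simp add: Cmp_assoc[of L B B X, symmetric]) (simp add: Cmp_assoc[of L B X X])
  then have "c \<cdot> (e \<cdot> l) = Zero C L X"
    using l e by (simp add: is_kernel_def Cmp_Zero[of L X X])
  then obtain k where k: "k \<in> Hom C L L" "l \<cdot> k = e \<cdot> l"
    using l(1,6) el unfolding is_kernel_def by blast
  have kn: "k [^]\<^bsub>End_ring C L\<^esub> n \<in> Hom C L L" using l k by (intro pow_in)
  have "l \<cdot> k [^]\<^bsub>End_ring C L\<^esub> n = l \<cdot> Zero C L L"
    using commute_pow[OF l(1,2) k(1) e(1) l(4) k(2), of n] e(4) l(1-4) by (simp add: Cmp_Zero[of L L B] Zero_Cmp[of L B B])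
  then have "k [^]\<^bsub>End_ring C L\<^esub> n = Zero C L L"
    by (intro kernel_monic[OF l(6,1,2,3,4,5) l(1) kn]) (use Zero_in l in auto)
  then have "((L, k), l, P, c, R) \<in> forget_exact C E n"
    using l k P R cN lE by (auto simp: forget_exact_def composable_pairs_def forget_obj_def forget_mor_def)
  then show ?thesis unfolding admissible_epic_def by blast
qed

lemma projective_lifting:
  "projective_object C E P \<longleftrightarrow> P \<in> Obj C \<and>
    (\<forall>Y g Z. admissible_epic E Y g Z \<longrightarrow> (\<forall>h\<in>Hom C P Z. \<exists>k\<in>Hom C P Y. g \<cdot> k = h))"
proof -
  have "(X, f, Y, g, Z) \<in> composable_pairs C \<and> is_kernel C X f Y g Z" if "(X, f, Y, g, Z) \<in> E" for X f Y g Z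
    using E_dest[OF that] by (simp add: composable_pairs_def)
  from projective_iff_lifting[OF this] show ?thesis .
qed

lemma nil_projective_lifting:
  "projective_object (nil_category C n) (forget_exact C E n) P \<longleftrightarrow> P \<in> Obj (nil_category C n) \<and>
    (\<forall>Y g Z. admissible_epic (forget_exact C E n) Y g Z \<longrightarrow>
      (\<forall>h\<in>Hom (nil_category C n) P Z. \<exists>k\<in>Hom (nil_category C n) P Y. g \<cdot> k = h))"
proof -
  interpret N: preadditive_category "nil_category C n" by (rule preadditive_nil_category)
  from N.projective_iff_lifting[OF forget_exact_kernel] show ?thesis
    by (simp only: nil_category_simps(4))
qed

lemma admissible_epic_dest:
  assumes "admissible_epic (forget_exact C E n) Y g Z"
  shows "Y \<in> Obj (nil_category C n)" "Z \<in> Obj (nil_category C n)" "g \<in> Hom (nil_category C n) Y Z"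
    "admissible_epic E (fst Y) g (fst Z)"
  using assms by (auto simp: admissible_epic_def forget_exact_def composable_pairs_def forget_obj_def forget_mor_def)

text \<open>By the adjunction, lifting problems for \<open>P\<close> are lifting problems for \<open>Q\<close> in \<open>C\<close>.\<close>

lemma free_on_projective:
  assumes free: "free_on C m P Q \<alpha> \<beta>" and Q: "projective_object C E Q"
  shows "projective_object (nil_category C (Suc m)) (forget_exact C E (Suc m)) P"
  unfolding nil_projective_lifting
proof (intro conjI allI impI ballI)
  let ?N = "nil_category C (Suc m)"
  interpret N: preadditive_category ?N by (rule preadditive_nil_category)
  show P: "P \<in> Obj ?N" using free unfolding free_on_def by blast
  have \<alpha>: "\<alpha> \<in> Hom C Q (fst P)" and QO: "Q \<in> Obj C" using free by (auto simp: free_on_def)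
  fix Y g Z h assume adm: "admissible_epic (forget_exact C E (Suc m)) Y g Z" and h: "h \<in> Hom ?N P Z"
  note d = admissible_epic_dest[OF adm]
  have "h \<cdot> \<alpha> \<in> Hom C Q (fst Z)" using P \<alpha> QO h d by (intro Cmp_in[of Q "fst P"]) auto
  then obtain k0 where k0: "k0 \<in> Hom C Q (fst Y)" "g \<cdot> k0 = h \<cdot> \<alpha>"
    using Q d(4) unfolding projective_lifting by blast
  obtain k where k: "k \<in> Hom ?N P Y" "k \<cdot> \<alpha> = k0" using free_on_extend[OF free d(1) k0(1)] .
  have "(g \<cdot> k) \<cdot> \<alpha> = h \<cdot> \<alpha>"
    using k k0 P d \<alpha> QO by (simp add: Cmp_assoc[of Q "fst P" "fst Y" "fst Z"])
  then have "g \<cdot> k = h"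
    by (rule free_on_unique[OF free d(2) N.Cmp_in[OF P d(1,2) k(1) d(3), unfolded nil_category_simps(4)] h])
  then show "\<exists>k\<in>Hom ?N P Y. g \<cdot> k = h" using k(1) by blast
qed

text \<open>Let \<open>C\<close> sit in the category of nilpotent endomorphisms as the objects \<open>(Y, 0)\<close>. Morphisms from \<open>P\<close> to
  \<open>(Y, 0)\<close> that extend \<open>h : Q \<rightarrow> Y\<close> along \<open>\<alpha>\<close> are given by \<open>h \<beta> e\<^sup>m\<close>, so lifting problems for \<open>Q\<close> are
  lifting problems for \<open>P\<close>.\<close>

lemma basis_projective:
  assumes free: "free_on C m P Q \<alpha> \<beta>"
    and P: "projective_object (nil_category C (Suc m)) (forget_exact C E (Suc m)) P"
  shows "projective_object C E Q"
  unfolding projective_lifting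
proof (intro conjI allI impI ballI)
  let ?N = "nil_category C (Suc m)"
  obtain X e where P' [simp]: "P = (X, e)" by (cases P)
  show Q: "Q \<in> Obj C" using free unfolding free_on_def by blast
  have o: "X \<in> Obj C" "e \<in> Hom C X X" "\<alpha> \<in> Hom C Q X" "\<beta> \<in> Hom C X Q" and nil: "e [^]\<^bsub>End_ring C X\<^esub> Suc m = Zero C X X"
    and \<beta>\<alpha>: "\<beta> \<cdot> e [^]\<^bsub>End_ring C X\<^esub> m \<cdot> \<alpha> = Idn C Q"
    using free by (auto simp: free_on_def simp del: Group.nat_pow_Suc)
  let ?e = "e [^]\<^bsub>End_ring C X\<^esub> m"
  have em: "?e \<in> Hom C X X" using o by (intro pow_in)
  fix Y g Z h assume adm: "admissible_epic E Y g Z" and h: "h \<in> Hom C Q Z"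
  have g: "Y \<in> Obj C" "Z \<in> Obj C" "g \<in> Hom C Y Z" using adm by (auto simp: admissible_epic_def dest: E_dest)
  have zN: "(W, Zero C W W) \<in> Obj ?N" if "W \<in> Obj C" for W
    using that by (simp add: Zero_in Cmp_Zero[of W W W] pow_in)
  have gN: "g \<in> Hom ?N (Y, Zero C Y Y) (Z, Zero C Z Z)"
    using g by (simp add: Cmp_Zero[of Y Y Z] Zero_Cmp[of Y Z Z])
  have admN: "admissible_epic (forget_exact C E (Suc m)) (Y, Zero C Y Y) g (Z, Zero C Z Z)"
    using adm gN g by (intro admissible_epic_forget_exact zN) auto
  \<comment> \<open>\<open>\<beta> e\<^sup>m\<close> is the projection to the summand generated by \<open>\<alpha>\<close>; it annihilates the image of \<open>e\<close>.\<close>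
  let ?b = "\<beta> \<cdot> ?e"
  have b: "?b \<in> Hom C X Q" using o em Q by (intro Cmp_in[of X X Q])
  have hb: "h \<cdot> ?b \<in> Hom C X Z" using o g h b Q by (intro Cmp_in[of X Q Z])
  have "?b \<cdot> e = Zero C X Q"
    using o em Q nil by (simp add: Cmp_assoc[of X X X Q] Cmp_Zero[of X X Q])
  then have "(h \<cdot> ?b) \<cdot> e = Zero C X Z"
    using o g h b Q by (simp add: Cmp_assoc[of X X Q Z] Cmp_Zero[of X Q Z])
  then have "h \<cdot> ?b \<in> Hom ?N P (Z, Zero C Z Z)"
    using o g hb by (simp add: Zero_Cmp[of X Z Z])
  then obtain k where k: "k \<in> Hom ?N P (Y, Zero C Y Y)" "g \<cdot> k = h \<cdot> ?b"
    using P admN unfolding nil_projective_lifting by blast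
  have kX: "k \<in> Hom C X Y" using k by simp
  have "g \<cdot> (k \<cdot> \<alpha>) = (h \<cdot> ?b) \<cdot> \<alpha>"
    using k(2) kX g o Q by (simp add: Cmp_assoc[of Q X Y Z, symmetric])
  also have "\<dots> = h" using o g h b Q \<beta>\<alpha> by (simp add: Cmp_assoc[of Q X Q Z] Cmp_Idn[of Q Z])
  finally show "\<exists>k\<in>Hom C Q Y. g \<cdot> k = h" using Cmp_in[OF Q o(1) g(1) o(3) kX] by blast
qed

text \<open>The counit \<open>c : T(X) \<rightarrow> (X, e)\<close> is split by the first inclusion in \<open>C\<close>, hence an admissible
  epic, and therefore split by some \<open>s\<close> compatible with \<open>e\<close> if \<open>(X, e)\<close> is projective. Expanding \<open>c\<close>
  turns \<open>c s = 1\<close> into an equation for a transfer sum.\<close>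

lemma projective_contraction:
  assumes idc: "idempotent_complete C"
    and P: "projective_object (nil_category C (Suc m)) (forget_exact C E (Suc m)) P"
  obtains h where "h \<in> Hom C (fst P) (fst P)" "transfer_sum (End_ring C (fst P)) (snd P) m h = Idn C (fst P)"
proof -
  let ?N = "nil_category C (Suc m)"
  obtain X e where P' [simp]: "P = (X, e)" by (cases P)
  have PN: "P \<in> Obj ?N" using P unfolding nil_projective_lifting by blast
  have o: "X \<in> Obj C" "e \<in> Hom C X X" using PN by auto
  obtain \<alpha> \<beta> where free: "free_on C m (T_obj C (Suc m) X) X \<alpha> \<beta>" using T_obj_free[OF o(1)] by blast
  obtain B t where T: "T_obj C (Suc m) X = (B, t)" by (cases "T_obj C (Suc m) X")
  note free = free[unfolded T]
  have TN: "(B, t) \<in> Obj ?N" using free unfolding free_on_def by blast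
  have t: "B \<in> Obj C" "t \<in> Hom C B B" "\<alpha> \<in> Hom C X B" "\<beta> \<in> Hom C B X" using free by (auto simp: free_on_def)
  obtain c where c: "c \<in> Hom ?N (B, t) P" "c \<cdot> \<alpha> = Idn C X"
    using free_on_extend[OF free PN, of "Idn C X"] Idn_in o by auto
  have cC: "c \<in> Hom C B X" using c(1) by simp
  have "admissible_epic E B c X" using split_epic_admissible[OF idc t(1) o(1) cC t(3) c(2)] .
  then have "admissible_epic (forget_exact C E (Suc m)) (B, t) c P"
    using TN PN c(1) by (intro admissible_epic_forget_exact) simp_all
  moreover have "Idn C X \<in> Hom ?N P P" using o by (simp add: Idn_in Cmp_Idn[of X X] Idn_Cmp[of X X])
  ultimately obtain s where s: "s \<in> Hom ?N P (B, t)" "c \<cdot> s = Idn C X"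
    using P unfolding nil_projective_lifting by blast
  have sC: "s \<in> Hom C X B" "s \<cdot> e = t \<cdot> s" using s(1) by auto
  let ?e = "\<lambda>k::nat. e [^]\<^bsub>End_ring C X\<^esub> k" and ?t = "\<lambda>k::nat. t [^]\<^bsub>End_ring C B\<^esub> k"
  have pw: "?e k \<in> Hom C X X" "?t k \<in> Hom C B B" for k using o t by (auto intro: pow_in)
  have ce: "c = finprod (hom_group C B X) (\<lambda>j. ?e j \<cdot> (\<beta> \<cdot> ?t (m - j))) {..m}"
    using free_on_expand[OF free PN c(1)] o pw by (simp add: c(2) Cmp_Idn[of X X])
  have \<beta>s: "\<beta> \<cdot> s \<in> Hom C X X" using o t sC by (intro Cmp_in[of X B X])
  have summand: "(?e j \<cdot> (\<beta> \<cdot> ?t (m - j))) \<cdot> s = ?e j \<cdot> (\<beta> \<cdot> s) \<cdot> ?e (m - j)" for j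
  proof -
    have "(?e j \<cdot> (\<beta> \<cdot> ?t (m - j))) \<cdot> s = ?e j \<cdot> (\<beta> \<cdot> (?t (m - j) \<cdot> s))"
      using o t pw sC(1) Cmp_in[of B B X "?t (m - j)" \<beta>]
      by (simp add: Cmp_assoc[of X B X X] Cmp_assoc[of X B B X])
    also have "?t (m - j) \<cdot> s = s \<cdot> ?e (m - j)" using commute_pow[OF o(1) t(1) o(2) t(2) sC] ..
    also have "\<beta> \<cdot> (s \<cdot> ?e (m - j)) = (\<beta> \<cdot> s) \<cdot> ?e (m - j)"
      using o t pw sC by (intro Cmp_assoc[symmetric])
    also have "?e j \<cdot> ((\<beta> \<cdot> s) \<cdot> ?e (m - j)) = ?e j \<cdot> (\<beta> \<cdot> s) \<cdot> ?e (m - j)"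
      by (rule Cmp_assoc[of X X X X, symmetric]) (use o pw \<beta>s in simp_all)
    finally show ?thesis .
  qed
  have in_Hom: "?e j \<cdot> (\<beta> \<cdot> ?t (m - j)) \<in> Hom C B X" for j
    by (rule Cmp_in[of B X X]) (use o t pw Cmp_in[of B B X _ \<beta>] in simp_all)
  have "Idn C X = finprod (hom_group C B X) (\<lambda>j. ?e j \<cdot> (\<beta> \<cdot> ?t (m - j))) {..m} \<cdot> s"
    using s(2) ce by simp
  also have "\<dots> = finprod (hom_group C X X) (\<lambda>j. (?e j \<cdot> (\<beta> \<cdot> ?t (m - j))) \<cdot> s) {..m}"
    using o t sC(1) in_Hom by (intro finprod_Cmp) auto
  also have "\<dots> = transfer_sum (End_ring C X) e m (\<beta> \<cdot> s)"
    by (simp add: summand transfer_sum_End_ring)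
  finally show ?thesis using that[of "\<beta> \<cdot> s"] \<beta>s by simp
qed

text \<open>For \<open>q\<close> from \<open>exists_matrix_unit\<close>, \<open>q e\<^sup>m\<close> is idempotent; its image is the object \<open>Q\<close> generating
  \<open>P\<close>.\<close>

lemma free_on_of_contraction:
  assumes idc: "idempotent_complete C" and P: "P \<in> Obj (nil_category C (Suc m))"
    and h: "h \<in> Hom C (fst P) (fst P)" "transfer_sum (End_ring C (fst P)) (snd P) m h = Idn C (fst P)"
  obtains Q \<alpha> \<beta> where "free_on C m P Q \<alpha> \<beta>"
proof -
  obtain X e where P' [simp]: "P = (X, e)" by (cases P)
  interpret e: nilpotent_element "End_ring C X" e m using nilpotent_End[OF P] by simp
  have o: "X \<in> Obj C" "e \<in> Hom C X X" using P by auto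
  let ?e = "\<lambda>k::nat. e [^]\<^bsub>End_ring C X\<^esub> k"
  have pw: "?e k \<in> Hom C X X" for k using o by (auto intro: pow_in)
  obtain q where q: "q \<in> Hom C X X" "transfer_sum (End_ring C X) e m q = Idn C X"
    and qq: "q \<cdot> ?e m \<cdot> q = q" and ort: "\<And>k. k < m \<Longrightarrow> q \<cdot> ?e k \<cdot> q = Zero C X X"
    using e.exists_matrix_unit[of h] h by auto
  let ?f = "q \<cdot> ?e m"
  have f: "?f \<in> Hom C X X" using o q pw by (intro Cmp_in[of X X X])
  have "?f \<cdot> ?f = ?f" using o q pw f qq by (simp add: Cmp_assoc[of X X X X, symmetric])
  then obtain Q \<gamma> \<alpha> where Q: "Q \<in> Obj C" "\<gamma> \<in> Hom C X Q" "\<alpha> \<in> Hom C Q X" "?f = \<alpha> \<cdot> \<gamma>" "\<gamma> \<cdot> \<alpha> = Idn C Q"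
    using idc o(1) f unfolding idempotent_complete_def by metis
  have \<alpha>q: "\<alpha> \<cdot> (\<gamma> \<cdot> q) = q"
    using o Q(1-3) q(1) qq by (simp add: Cmp_assoc[of X X Q X, symmetric] Q(4)[symmetric])
  have f\<alpha>: "?f \<cdot> \<alpha> = \<alpha>" using o Q(1-3,5) by (simp add: Q(4) Cmp_assoc[of Q X Q X] Cmp_Idn[of Q X])
  have ort': "(\<gamma> \<cdot> q) \<cdot> ?e k \<cdot> \<alpha> = (if k = m then Idn C Q else Zero C Q Q)" if "k \<le> m" for k
  proof -
    have "(\<gamma> \<cdot> q) \<cdot> ?e k \<cdot> \<alpha> = \<gamma> \<cdot> ((q \<cdot> ?e k) \<cdot> \<alpha>)"
      using o Q(1-3) q(1) pw Cmp_in[of X X X "?e k" q] by (simp add: Cmp_assoc[of X X X Q] Cmp_assoc[of Q X X Q])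
    also have "\<dots> = (if k = m then Idn C Q else Zero C Q Q)"
    proof (cases "k = m")
      case True
      then show ?thesis using f\<alpha> Q by simp
    next
      case False
      then have k: "k < m" using that by simp
      have qk: "q \<cdot> ?e k \<in> Hom C X X" using o q pw by (intro Cmp_in[of X X X])
      have "(q \<cdot> ?e k) \<cdot> \<alpha> = (q \<cdot> ?e k) \<cdot> (?f \<cdot> \<alpha>)" by (simp only: f\<alpha>)
      also have "\<dots> = (q \<cdot> ?e k) \<cdot> (q \<cdot> (?e m \<cdot> \<alpha>))"
        using o Q(1-3) q(1) pw by (simp add: Cmp_assoc[of Q X X X])
      also have "\<dots> = ((q \<cdot> ?e k) \<cdot> q) \<cdot> (?e m \<cdot> \<alpha>)"
        using o Q(1-3) q(1) pw qk by (intro Cmp_assoc[of Q X X X, symmetric] Cmp_in[of Q X X])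
      also have "\<dots> = Zero C Q X"
        using o Q(1-3) pw Cmp_in[of Q X X \<alpha> "?e m"] by (simp add: ort[OF k] Zero_Cmp[of Q X X])
      finally show ?thesis using False o Q by (simp add: Cmp_Zero[of Q X Q])
    qed
    finally show ?thesis .
  qed
  have "\<gamma> \<cdot> q \<in> Hom C X Q" using o Q q by (intro Cmp_in[of X X Q])
  then have "free_on C m P Q \<alpha> (\<gamma> \<cdot> q)"
    using P Q(1-3) q(2) ort' by (simp add: free_on_def \<alpha>q)
  then show ?thesis by (rule that)
qed

theorem nil_projective_iff_free:
  assumes "idempotent_complete C"
  shows "projective_object (nil_category C (Suc m)) (forget_exact C E (Suc m)) P \<longleftrightarrow>
    (\<exists>Q \<alpha> \<beta>. projective_object C E Q \<and> free_on C m P Q \<alpha> \<beta>)"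
proof
  assume P: "projective_object (nil_category C (Suc m)) (forget_exact C E (Suc m)) P"
  then have "P \<in> Obj (nil_category C (Suc m))" unfolding nil_projective_lifting by blast
  then show "\<exists>Q \<alpha> \<beta>. projective_object C E Q \<and> free_on C m P Q \<alpha> \<beta>"
    using projective_contraction[OF assms P] free_on_of_contraction[OF assms] basis_projective[OF _ P] by metis
qed (auto intro: free_on_projective)

lemma isomorphic_T_obj_iff_free:
  assumes "Q \<in> Obj C"
  shows "isomorphic (nil_category C (Suc m)) P (T_obj C (Suc m) Q) \<longleftrightarrow> (\<exists>\<alpha> \<beta>. free_on C m P Q \<alpha> \<beta>)"
  using T_obj_free[OF assms] free_on_isomorphic free_on_transport by blast

end

section \<open>Opposite categories\<close>

definition opposite :: "('o, 'm) additive_data \<Rightarrow> ('o, 'm) additive_data" where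
  "opposite C = \<lparr>Obj = Obj C, Hom = (\<lambda>X Y. Hom C Y X), Idn = Idn C, Cmp = (\<lambda>g f. Cmp C f g),
     Add = Add C, Zero = (\<lambda>X Y. Zero C Y X)\<rparr>"

definition opposite_sequences :: "('o, 'm) sequence set \<Rightarrow> ('o, 'm) sequence set" where
  "opposite_sequences E = {(Z, g, Y, f, X). (X, f, Y, g, Z) \<in> E}"

lemma opposite_simps [simp]:
  "Obj (opposite C) = Obj C" "Hom (opposite C) X Y = Hom C Y X" "Idn (opposite C) = Idn C"
  "Cmp (opposite C) g f = Cmp C f g" "Add (opposite C) = Add C" "Zero (opposite C) X Y = Zero C Y X"
  "hom_group (opposite C) X Y = hom_group C Y X"
  by (simp_all add: opposite_def hom_group_def)

lemma opposite_sequences_iff [simp]: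
  "(Z, g, Y, f, X) \<in> opposite_sequences E \<longleftrightarrow> (X, f, Y, g, Z) \<in> E"
  by (simp add: opposite_sequences_def)

lemma is_kernel_opposite [simp]: "is_kernel (opposite C) Z g Y f X = is_cokernel C X f Y g Z"
  by (simp add: is_kernel_def is_cokernel_def)

lemma is_cokernel_opposite [simp]: "is_cokernel (opposite C) Z g Y f X = is_kernel C X f Y g Z"
  by (simp add: is_kernel_def is_cokernel_def)

lemma composable_pairs_opposite [simp]:
  "(Z, g, Y, f, X) \<in> composable_pairs (opposite C) \<longleftrightarrow> (X, f, Y, g, Z) \<in> composable_pairs C"
  by (auto simp: composable_pairs_def)

lemma admissible_opposite [simp]:
  "admissible_monic (opposite_sequences E) Z g Y = admissible_epic E Y g Z"
  "admissible_epic (opposite_sequences E) Y f X = admissible_monic E X f Y"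
  by (auto simp: admissible_monic_def admissible_epic_def)

lemma is_pushout_opposite [simp]:
  "is_pushout (opposite C) Z g Y c Z' g' c' Y' = is_pullback C Y g Z c Z' g' c' Y'"
  by (simp add: is_pushout_def is_pullback_def)

lemma is_pullback_opposite [simp]:
  "is_pullback (opposite C) Y f X a X' f' a' Y' = is_pushout C X f Y a X' f' a' Y'"
  by (simp add: is_pushout_def is_pullback_def)

lemma is_iso_opposite [simp]: "is_iso (opposite C) X Y f = is_iso C Y X f"
  by (auto simp: is_iso_def)

lemma is_biproduct_opposite:
  "is_biproduct C n X B \<iota> \<pi> \<Longrightarrow> is_biproduct (opposite C) n X B \<pi> \<iota>"
  by (auto simp: is_biproduct_def)

lemma idempotent_complete_opposite: "idempotent_complete C \<Longrightarrow> idempotent_complete (opposite C)"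
  unfolding idempotent_complete_def opposite_simps by metis

text \<open>Reversing arrows turns an isomorphism of sequences into one in the opposite direction, so closure
  under isomorphism of the opposite structure is tested on the inverses.\<close>

lemma (in category_axms) iso_square_inverse:
  assumes o: "X \<in> Obj C" "Y \<in> Obj C" "X' \<in> Obj C" "Y' \<in> Obj C"
    and f: "f \<in> Hom C X Y" "f' \<in> Hom C X' Y'"
    and a: "a \<in> Hom C X' X" "a' \<in> Hom C X X'" "a \<cdot> a' = Idn C X"
    and b: "b \<in> Hom C Y' Y" "b' \<in> Hom C Y Y'" "b' \<cdot> b = Idn C Y'"
    and sq: "b \<cdot> f' = f \<cdot> a"
  shows "f' \<cdot> a' = b' \<cdot> f"
proof -
  have fa: "f' \<cdot> a' \<in> Hom C X Y'" using o f a by (intro Cmp_in[of X X' Y'])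
  have "f' \<cdot> a' = (b' \<cdot> b) \<cdot> (f' \<cdot> a')" using o fa by (simp add: b(3) Idn_Cmp)
  also have "\<dots> = b' \<cdot> ((b \<cdot> f') \<cdot> a')"
    using o f a(1,2) b(1,2) fa by (simp add: Cmp_assoc[of X Y' Y Y'] Cmp_assoc[of X X' Y' Y])
  also have "\<dots> = b' \<cdot> f"
    using o f a by (simp add: sq Cmp_assoc[of X X' X Y] Cmp_Idn)
  finally show ?thesis .
qed

context exact_category
begin

lemma exact_category_opposite: "exact_category (opposite C) (opposite_sequences E)"
proof (intro exact_category.intro additive_category.intro preadditive_category.intro category_axms.intro
    preadditive_category_axioms.intro additive_category_axioms.intro exact_category_axioms.intro)
  fix n :: nat and X
  assume "\<And>i. i \<in> {1..n} \<Longrightarrow> X i \<in> Obj (opposite C)"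
  then obtain B \<iota> \<pi> where "is_biproduct C n X B \<iota> \<pi>" using biproducts[of n X] by auto
  then show "\<exists>B \<iota> \<pi>. is_biproduct (opposite C) n X B \<iota> \<pi>"
    using is_biproduct_opposite by (intro exI)
next
  show "opposite_sequences E \<subseteq> kernel_cokernel_pairs (opposite C)"
    using E_kernel_cokernel by (auto simp: kernel_cokernel_pairs_def)
next
  fix X f Y g Z X' f' Y' g' Z' a b c
  assume seq: "(X, f, Y, g, Z) \<in> opposite_sequences E"
    and comp: "(X', f', Y', g', Z') \<in> composable_pairs (opposite C)"
    and iso: "is_iso (opposite C) X X' a" "is_iso (opposite C) Y Y' b" "is_iso (opposite C) Z Z' c"
    and sq: "f' \<cdot>\<^bsub>opposite C\<^esub> a = b \<cdot>\<^bsub>opposite C\<^esub> f" "g' \<cdot>\<^bsub>opposite C\<^esub> b = c \<cdot>\<^bsub>opposite C\<^esub> g"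
  note s = E_dest[OF seq[unfolded opposite_sequences_iff]]
  have o: "X' \<in> Obj C" "Y' \<in> Obj C" "Z' \<in> Obj C" "g' \<in> Hom C Z' Y'" "f' \<in> Hom C Y' X'"
    using comp by (auto simp: composable_pairs_def)
  have inv: "\<exists>h'. h \<in> Hom C W' W \<and> h' \<in> Hom C W W' \<and> h' \<cdot> h = Idn C W' \<and> h \<cdot> h' = Idn C W \<and> is_iso C W W' h'"
    if "is_iso C W' W h" for W W' h
    using that by (auto simp: is_iso_def)
  obtain a' where a: "a \<in> Hom C X' X" "a' \<in> Hom C X X'" "a' \<cdot> a = Idn C X'" "a \<cdot> a' = Idn C X" "is_iso C X X' a'"
    using inv iso(1) by (metis is_iso_opposite)
  obtain b' where b: "b \<in> Hom C Y' Y" "b' \<in> Hom C Y Y'" "b' \<cdot> b = Idn C Y'" "b \<cdot> b' = Idn C Y" "is_iso C Y Y' b'"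
    using inv iso(2) by (metis is_iso_opposite)
  obtain c' where c: "c \<in> Hom C Z' Z" "c' \<in> Hom C Z Z'" "c' \<cdot> c = Idn C Z'" "c \<cdot> c' = Idn C Z" "is_iso C Z Z' c'"
    using inv iso(3) by (metis is_iso_opposite)
  have "f' \<cdot> b' = a' \<cdot> f"
    using sq(1) by (intro iso_square_inverse[OF s(2,3) o(2,1) s(5) o(5) b(1,2,4) a(1,2,3)]) simp
  moreover have "g' \<cdot> c' = b' \<cdot> g"
    using sq(2) by (intro iso_square_inverse[OF s(1,2) o(3,2) s(4) o(4) c(1,2,4) b(1,2,3)]) simp
  ultimately have "(Z', g', Y', f', X') \<in> E"
    using E_iso_closed[OF seq[unfolded opposite_sequences_iff] _ c(5) b(5) a(5)] comp by simp
  then show "(X', f', Y', g', Z') \<in> opposite_sequences E" by simp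
next
  fix X f Y X' a
  assume "admissible_monic (opposite_sequences E) X f Y" "X' \<in> Obj (opposite C)" "a \<in> Hom (opposite C) X X'"
  then show "\<exists>Y' f' a'. is_pushout (opposite C) X f Y a X' f' a' Y' \<and> admissible_monic (opposite_sequences E) X' f' Y'"
    unfolding is_pushout_opposite admissible_opposite opposite_simps by (rule epic_pullback)
next
  fix Y g Z Z' c
  assume "admissible_epic (opposite_sequences E) Y g Z" "Z' \<in> Obj (opposite C)" "c \<in> Hom (opposite C) Z' Z"
  then show "\<exists>Y' g' c'. is_pullback (opposite C) Y g Z c Z' g' c' Y' \<and> admissible_epic (opposite_sequences E) Y' g' Z'"
    unfolding is_pullback_opposite admissible_opposite opposite_simps by (rule monic_pushout)
qed (auto simp: Idn_in Cmp_in Cmp_Idn Idn_Cmp Cmp_assoc hom_comm_group Cmp_Add_left Cmp_Add_right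
    Idn_monic Idn_epic monic_Cmp epic_Cmp)

end

lemma projective_opposite:
  "projective_object (opposite C) (opposite_sequences E) I \<longleftrightarrow> injective_object C E I"
  by (auto simp: projective_object_def injective_object_def)

lemma (in preadditive_category) End_opposite_pow:
  assumes "X \<in> Obj C" "e \<in> Hom C X X"
  shows "e [^]\<^bsub>End_ring (opposite C) X\<^esub> (k::nat) = e [^]\<^bsub>End_ring C X\<^esub> k"
proof -
  interpret ring "End_ring C X" using assms by (intro ring_End_ring)
  show ?thesis
    by (induction k) (use assms nat_pow_Suc2[of e] in simp_all)
qed

lemma (in preadditive_category) nil_category_opposite:
  "nil_category (opposite C) n = opposite (nil_category C n)"
proof (rule additive_data.equality)
  show "Obj (nil_category (opposite C) n) = Obj (opposite (nil_category C n))"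
    unfolding set_eq_iff nil_category_simps opposite_simps using End_opposite_pow by metis
  show "Hom (nil_category (opposite C) n) = Hom (opposite (nil_category C n))"
    by (intro ext) (auto simp: set_eq_iff)
qed (auto simp: fun_eq_iff)

lemma (in preadditive_category) forget_exact_opposite:
  "forget_exact (opposite C) (opposite_sequences E) n = opposite_sequences (forget_exact C E n)"
  by (auto simp: forget_exact_def nil_category_opposite forget_obj_def forget_mor_def)

text \<open>The transfer sum is reversed term by term, which is the substitution \<open>j \<mapsto> m - j\<close>.\<close>

lemma (in preadditive_category) free_on_opposite:
  "free_on (opposite C) m P Q \<beta> \<alpha> \<longleftrightarrow> free_on C m P Q \<alpha> \<beta>"
proof (cases "P \<in> Obj (nil_category C (Suc m)) \<and> Q \<in> Obj C \<and> \<alpha> \<in> Hom C Q (fst P) \<and> \<beta> \<in> Hom C (fst P) Q")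
  case False
  then show ?thesis unfolding free_on_def nil_category_opposite opposite_simps by blast
next
  case True
  obtain X e where P [simp]: "P = (X, e)" by (cases P)
  have o: "X \<in> Obj C" "Q \<in> Obj C" "e \<in> Hom C X X" "\<alpha> \<in> Hom C Q X" "\<beta> \<in> Hom C X Q" using True by auto
  interpret XX: comm_group "hom_group C X X" using o by (intro hom_comm_group)
  let ?e = "\<lambda>k::nat. e [^]\<^bsub>End_ring C X\<^esub> k"
  have pw: "?e k \<in> Hom C X X" for k using o by (intro pow_in)
  have ab: "\<alpha> \<cdot> \<beta> \<in> Hom C X X" using o by (intro Cmp_in[of X Q X])
  have in_Hom: "?e j \<cdot> (\<alpha> \<cdot> \<beta>) \<cdot> ?e k \<in> Hom C X X" for j k
    by (rule Cmp_in[of X X X]) (use o ab pw Cmp_in[of X X X "\<alpha> \<cdot> \<beta>" "?e j"] in simp_all)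
  have img: "(\<lambda>j. m - j) ` {..m} = {..m}"
  proof -
    have "j \<in> (\<lambda>j. m - j) ` {..m}" if "j \<le> m" for j
      using that by (intro image_eqI[of _ _ "m - j"]) auto
    then show ?thesis by auto
  qed
  have "transfer_sum (End_ring C X) e m (\<alpha> \<cdot> \<beta>)
      = finprod (hom_group C X X) (\<lambda>j. ?e j \<cdot> (\<alpha> \<cdot> \<beta>) \<cdot> ?e (m - j)) ((\<lambda>j. m - j) ` {..m})"
    by (simp add: transfer_sum_End_ring img)
  also have "\<dots> = finprod (hom_group C X X) (\<lambda>j. ?e (m - j) \<cdot> (\<alpha> \<cdot> \<beta>) \<cdot> ?e (m - (m - j))) {..m}"
    using in_Hom by (intro XX.finprod_reindex) (auto simp: inj_on_def)
  also have "\<dots> = finprod (hom_group C X X) (\<lambda>j. ?e (m - j) \<cdot> ((\<alpha> \<cdot> \<beta>) \<cdot> ?e j)) {..m}"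
    using in_Hom o ab pw by (intro XX.finprod_cong') (auto simp: Cmp_assoc[of X X X X])
  also have "\<dots> = transfer_sum (End_ring (opposite C) X) e m (\<alpha> \<cdot> \<beta>)"
    using o by (simp add: transfer_sum_End_ring End_opposite_pow)
  finally have tr: "transfer_sum (End_ring (opposite C) X) e m (\<alpha> \<cdot> \<beta>) = transfer_sum (End_ring C X) e m (\<alpha> \<cdot> \<beta>)" ..
  have "\<beta> \<cdot> (?e k \<cdot> \<alpha>) = \<beta> \<cdot> ?e k \<cdot> \<alpha>" for k
    using o pw by (simp add: Cmp_assoc[of Q X X Q])
  then show ?thesis
    using True o by (simp add: free_on_def nil_category_opposite tr End_opposite_pow)
qed

section \<open>Projectives and injectives with a nilpotent endomorphism\<close>

theorem proposition3p6:
  fixes C :: "('o, 'm) additive_data"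
    and E :: "('o, 'm) sequence set"
    and n :: nat
  assumes "n \<ge> 2"
    and "exact_category C E"
    and "idempotent_complete C"
  shows "(\<forall>P. projective_object (nil_category C n) (forget_exact C E n) P \<longleftrightarrow>
            (\<exists>Q. projective_object C E Q \<and> isomorphic (nil_category C n) P (T_obj C n Q)))
       \<and> (\<forall>I. injective_object (nil_category C n) (forget_exact C E n) I \<longleftrightarrow>
            (\<exists>J. injective_object C E J \<and> isomorphic (nil_category C n) I (T_obj C n J)))"
proof -
  interpret exact_category C E by fact
  interpret op: exact_category "opposite C" "opposite_sequences E" by (rule exact_category_opposite)
  obtain m where n: "n = Suc m" using assms(1) by (cases n) auto
  have Q: "Q \<in> Obj C" if "projective_object C E Q \<or> injective_object C E Q" for Q
    using that by (auto simp: projective_object_def injective_object_def)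
  \<comment> \<open>The projective case in the opposite category, in which the roles of \<open>\<alpha>\<close> and \<open>\<beta>\<close> are exchanged.\<close>
  have "injective_object (nil_category C n) (forget_exact C E n) I \<longleftrightarrow>
      (\<exists>J \<alpha> \<beta>. injective_object C E J \<and> free_on C m I J \<alpha> \<beta>)" for I
    using op.nil_projective_iff_free[OF idempotent_complete_opposite[OF assms(3)], of m I]
    unfolding nil_category_opposite forget_exact_opposite projective_opposite free_on_opposite n by blast
  then show ?thesis
    using nil_projective_iff_free[OF assms(3), of m] isomorphic_T_obj_iff_free[of _ m] Q unfolding n by metis
qed

end
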